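(* Let $c>1$ be a constant and, for each integer $n\ge c$, let $H_n$ be the giant component of the Erdős–Rényi random graph $G(n,c/n)$. Then $H_n$ has no spectral gap asymptotically almost surely. That is, if $\lambda_1(H_n)$ denotes the smallest non-zero eigenvalue of the normalized Laplacian of $H_n$, then for every $\varepsilon>0$, $$\lim_{n\to\infty}\mathbb{P}\big(\lambda_1(H_n)<\varepsilon\big)=1 .$$
   Context: $G(n,p)$ is the random graph on $n$ labelled vertices in which each unordered pair of distinct vertices is joined by an edge independently with probability $p$. The giant component of $G(n,c/n)$, $c>1$, is its connected component with the largest number of vertices. (It is well known that with probability tending to $1$ it is unique and has size proportional to $n$; how ties are broken is irrelevant.) For a finite connected graph with at least two vertices, with adjacency matrix $A$ and diagonal degree matrix $D$, the normalized Laplacian is $I-D^{-1/2}AD^{-1/2}$. If $H_n$ is a single vertex (an event whose probability tends to $0$), $\lambda_1(H_n)$ may be assigned any value. The family has no spectral gap when the smallest non-zero eigenvalue of the Laplacian of $H_n$ goes to zero as $n\to\infty$; "asymptotically almost surely" refers to probability tending to $1$ as $n\to\infty$. *)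

theory Defs
  imports "HOL-Probability.Probability" "Jordan_Normal_Form.Spectral_Radius"
begin

(* A finite simple graph is a vertex set together with a set of two-element edges {u, v}. *)
type_synonym ugraph = "nat set \<times> nat set set"

abbreviation verts :: "ugraph \<Rightarrow> nat set" where "verts \<equiv> fst"
abbreviation edges :: "ugraph \<Rightarrow> nat set set" where "edges \<equiv> snd"

definition adjacent :: "ugraph \<Rightarrow> nat \<Rightarrow> nat \<Rightarrow> bool" where
  "adjacent G u v \<longleftrightarrow> {u, v} \<in> edges G"

definition vertex_degree :: "ugraph \<Rightarrow> nat \<Rightarrow> nat" where
  "vertex_degree G v = card {u \<in> verts G. adjacent G v u}"

definition induced_subgraph :: "ugraph \<Rightarrow> nat set \<Rightarrow> ugraph" where
  "induced_subgraph G U = (U, {e \<in> edges G. e \<subseteq> U})"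

definition graph_components :: "ugraph \<Rightarrow> ugraph set" where
  "graph_components G =
     (\<lambda>u. induced_subgraph G {v \<in> verts G. (adjacent G)\<^sup>*\<^sup>* u v}) ` verts G"

(* Several components may attain the maximum, hence a relation rather than a function. *)
definition is_giant_component :: "ugraph \<Rightarrow> ugraph \<Rightarrow> bool" where
  "is_giant_component G H \<longleftrightarrow>
     H \<in> graph_components G \<and> (\<forall>H' \<in> graph_components G. card (verts H') \<le> card (verts H))"

definition vertex_pairs :: "nat \<Rightarrow> nat set set" where
  "vertex_pairs n = {e. e \<subseteq> {..<n} \<and> card e = 2}"

(* G(n,p): the edge indicators are independent Bernoulli variables with parameter p. *)
definition gnp :: "nat \<Rightarrow> real \<Rightarrow> ugraph pmf" where
  "gnp n p =
     map_pmf (\<lambda>x. ({..<n}, {e \<in> vertex_pairs n. x e}))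
       (Pi_pmf (vertex_pairs n) False (\<lambda>_. bernoulli_pmf p))"

(* Rows and columns of the matrices below are indexed by the vertices in increasing order. *)
definition vertex :: "ugraph \<Rightarrow> nat \<Rightarrow> nat" where
  "vertex G i = sorted_list_of_set (verts G) ! i"

definition adjacency_matrix :: "ugraph \<Rightarrow> real Matrix.mat" where
  "adjacency_matrix G =
     Matrix.mat (card (verts G)) (card (verts G))
       (\<lambda>(i, j). if adjacent G (vertex G i) (vertex G j) then 1 else 0)"

(* The inverse square root of the diagonal degree matrix. *)
definition inv_sqrt_degree_matrix :: "ugraph \<Rightarrow> real Matrix.mat" where
  "inv_sqrt_degree_matrix G =
     mat_diag (card (verts G)) (\<lambda>i. 1 / sqrt (real (vertex_degree G (vertex G i))))"

definition normalized_laplacian :: "ugraph \<Rightarrow> real Matrix.mat" where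
  "normalized_laplacian G =
     1\<^sub>m (card (verts G))
       - inv_sqrt_degree_matrix G * adjacency_matrix G * inv_sqrt_degree_matrix G"

(* For a connected graph with at least two vertices the minimum is over a finite nonempty
   set. For a single vertex, where the value is a matter of convention, division by zero
   makes the matrix (1), so that the value is 1. *)
definition lambda1 :: "ugraph \<Rightarrow> real" where
  "lambda1 G = Min {x \<in> spectrum (normalized_laplacian G). x \<noteq> 0}"

end

theory Submission
  imports Defs
begin

text \<open>No information on the giant component is needed beyond its maximality. A connected graph with a
  vertex of degree at most \<open>m + 1\<close>, of which at least \<open>m\<close> neighbours are leaves (a broom), has a
  cut with at most one edge and volume at least \<open>2 m\<close> on one side, so \<open>\<lambda>\<^sub>1 \<le> 1 / m\<close> once the graph
  is large. By Chebyshev's inequality there are linearly many isolated vertices with high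
  probability. Adding to such a graph the edges of a star on isolated vertices, attached to a vertex
  of the largest component \<open>H\<close>, multiplies the probability by a factor of order \<open>n ^ - (m + 1)\<close> and
  can be done in order \<open>|H| n ^ (m + 1)\<close> ways. If \<open>H\<close> has no broom, the added star can be recognised
  in the result, so graphs of this kind have total probability \<open>O(1 / |H|)\<close>. The same switching with
  unattached stars shows that \<open>|H|\<close> exceeds any constant with high probability.\<close>

text \<open>Switching is a double count: if pairs (graph, star) map injectively to graphs, the
  weights of the images sum to at most 1. Everything thus rests on recovering the star from the
  result. If all degrees are below a constant, an unattached star of that size has the only vertex
  of large degree as its centre, and the number of stars exceeds the inverse weight factor by order
  n. Brooms are forbidden in \<open>H\<close> only and may occur elsewhere, so the shape of the star
  alone does not identify it; this is why it is attached to \<open>H\<close>. The enlarged component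
  is strictly larger than all others, hence it is the giant component of the result under any rule
  for breaking ties. If two preimages had different centres, both centres would lie in this
  component, and one would already be a broom centre inside the giant component of the other
  preimage. The gain is then only |H|, the number of attachment vertices.\<close>

no_notation inner (infix "\<bullet>" 70)
no_notation Finite_Cartesian_Product.vec_nth (infixl "$" 90)

section \<open>Rayleigh quotients of symmetric matrices\<close>

text \<open>Each product \<open>v $ i * v $ j\<close> is at most \<open>v \<bullet> v\<close> in
  absolute value. The bound stands in for an operator norm: it keeps the Rayleigh quotient bounded
  below and quantifies invertibility.\<close>

lemma quadratic_form_bound:
  fixes A :: "real Matrix.mat"
  assumes A: "A \<in> carrier_mat n n"
  obtains C where "C > 0"
    "\<And>v. v \<in> carrier_vec n \<Longrightarrow> \<bar>v \<bullet> (A *\<^sub>v v)\<bar> \<le> C * (v \<bullet> v)"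
proof -
  \<comment> \<open>The extra 1 keeps \<open>C\<close> positive for the zero matrix.\<close>
  define C where "C = (\<Sum>i<n. \<Sum>j<n. \<bar>A $$ (i, j)\<bar>) + 1"
  have "C > 0"
    unfolding C_def by (smt (verit) sum_nonneg abs_ge_zero)
  moreover have "\<bar>v \<bullet> (A *\<^sub>v v)\<bar> \<le> C * (v \<bullet> v)" if v: "v \<in> carrier_vec n" for v
  proof -
    define q where "q = v \<bullet> v"
    have q: "q = (\<Sum>i<n. (v $ i)\<^sup>2)"
      using v by (simp add: q_def scalar_prod_def power2_eq_square atLeast0LessThan)
    have q0: "q \<ge> 0"
      unfolding q by (simp add: sum_nonneg)
    have vi: "(v $ i)\<^sup>2 \<le> q" if "i < n" for i
      unfolding q using that by (intro member_le_sum) auto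
    have prod: "\<bar>v $ i * v $ j\<bar> \<le> q" if "i < n" "j < n" for i j
    proof -
      have "2 * \<bar>v $ i * v $ j\<bar> \<le> (v $ i)\<^sup>2 + (v $ j)\<^sup>2"
        using sum_squares_bound[of "\<bar>v $ i\<bar>" "\<bar>v $ j\<bar>"] by (simp add: abs_mult)
      then show ?thesis
        using vi[OF that(1)] vi[OF that(2)] by linarith
    qed
    have "v \<bullet> (A *\<^sub>v v) = (\<Sum>i<n. \<Sum>j<n. A $$ (i, j) * (v $ i * v $ j))"
      using v A by (simp add: scalar_prod_def atLeast0LessThan sum_distrib_left algebra_simps)
    also have "\<bar>\<dots>\<bar> \<le> (\<Sum>i<n. \<Sum>j<n. \<bar>A $$ (i, j)\<bar> * q)"
      by (intro order_trans[OF sum_abs] sum_mono) (auto simp: abs_mult prod[unfolded abs_mult] intro!: mult_left_mono)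
    also have "\<dots> = (C - 1) * q"
      by (simp add: C_def sum_distrib_right)
    also have "\<dots> \<le> C * q"
      using q0 by (simp add: algebra_simps)
    finally show ?thesis
      by (simp add: q_def)
  qed
  ultimately show ?thesis
    using that by blast
qed

lemma scalar_prod_transpose_mult_mat_vec:
  fixes A :: "real Matrix.mat"
  assumes "A \<in> carrier_mat n n" "u \<in> carrier_vec n" "v \<in> carrier_vec n"
  shows "(A *\<^sub>v u) \<bullet> v = u \<bullet> (transpose_mat A *\<^sub>v v)"
proof -
  have "(A *\<^sub>v u) \<bullet> v = (\<Sum>i<n. \<Sum>j<n. A $$ (i, j) * (u $ j * v $ i))"
    using assms by (simp add: scalar_prod_def atLeast0LessThan sum_distrib_right sum_distrib_left algebra_simps)
  also have "\<dots> = (\<Sum>j<n. \<Sum>i<n. A $$ (i, j) * (u $ j * v $ i))"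
    by (rule sum.swap)
  also have "\<dots> = u \<bullet> (transpose_mat A *\<^sub>v v)"
    using assms by (simp add: scalar_prod_def atLeast0LessThan sum_distrib_left algebra_simps)
  finally show ?thesis .
qed

lemma scalar_prod_self_pos:
  fixes v :: "real Matrix.vec"
  assumes "v \<in> carrier_vec n" "v \<noteq> 0\<^sub>v n"
  shows "v \<bullet> v > 0"
proof -
  obtain i where "i < n" "v $ i \<noteq> 0"
    using assms by (metis carrier_vecD eq_vecI index_zero_vec(1) zero_carrier_vec)
  then show ?thesis
    using assms by (auto simp: scalar_prod_def intro!: sum_pos2[of _ i] simp: zero_less_mult_iff)
qed

text \<open>The infimum \<open>\<mu>\<close> of the Rayleigh quotient is an eigenvalue: otherwise \<open>M - \<mu>\<close> would be
  positive semidefinite and invertible, hence bounded below by a positive constant.\<close>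

lemma symmetric_eigenvector_le_rayleigh:
  fixes M :: "real Matrix.mat"
  assumes M: "M \<in> carrier_mat n n" and sym: "transpose_mat M = M"
    and f: "f \<in> carrier_vec n" "f \<noteq> 0\<^sub>v n"
  obtains v \<mu> where "v \<in> carrier_vec n" "v \<noteq> 0\<^sub>v n" "M *\<^sub>v v = \<mu> \<cdot>\<^sub>v v"
    "\<mu> * (f \<bullet> f) \<le> f \<bullet> (M *\<^sub>v f)"
proof -
  define W :: "real Matrix.vec set" where "W = {v \<in> carrier_vec n. v \<noteq> 0\<^sub>v n}"
  define R where "R v = (v \<bullet> (M *\<^sub>v v)) / (v \<bullet> v)" for v
  define \<mu> where "\<mu> = Inf (R ` W)"
  have pos: "v \<bullet> v > 0" if "v \<in> W" for v
    using that scalar_prod_self_pos by (auto simp: W_def)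
  obtain C where C: "C > 0"
      "\<And>v. v \<in> carrier_vec n \<Longrightarrow> \<bar>v \<bullet> (M *\<^sub>v v)\<bar> \<le> C * (v \<bullet> v)"
    using quadratic_form_bound[OF M] by metis
  have bdd: "bdd_below (R ` W)"
  proof (rule bdd_belowI2)
    fix v assume v: "v \<in> W"
    then have "- C * (v \<bullet> v) \<le> v \<bullet> (M *\<^sub>v v)"
      using C(2)[of v] by (auto simp: W_def)
    then show "- C \<le> R v"
      using pos[OF v] by (simp add: R_def field_simps)
  qed
  have \<mu>_le: "\<mu> * (v \<bullet> v) \<le> v \<bullet> (M *\<^sub>v v)" if "v \<in> W" for v
  proof -
    have "\<mu> \<le> R v"
      unfolding \<mu>_def using bdd that by (intro cInf_lower) auto
    then show ?thesis
      using pos[OF that] by (simp add: R_def field_simps)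
  qed
  define N where "N = M - \<mu> \<cdot>\<^sub>m 1\<^sub>m n"
  have N: "N \<in> carrier_mat n n"
    using M by (auto simp: N_def)
  have Nt: "transpose_mat N = N"
    using M sym by (auto simp: N_def intro!: eq_matI) (metis carrier_matD index_transpose_mat(1))+
  have Nv: "N *\<^sub>v v = M *\<^sub>v v - \<mu> \<cdot>\<^sub>v v" if "v \<in> carrier_vec n" for v
    unfolding N_def using M that
    by (subst minus_mult_distrib_mat_vec[of _ n n]) (auto intro!: arg_cong2[of _ _ _ _ "(-)"] eq_vecI)
  have qN: "v \<bullet> (N *\<^sub>v v) = v \<bullet> (M *\<^sub>v v) - \<mu> * (v \<bullet> v)" if "v \<in> carrier_vec n" for v
    using that M by (simp add: Nv scalar_prod_minus_distrib[of _ n])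
  have psd: "v \<bullet> (N *\<^sub>v v) \<ge> 0" if "v \<in> carrier_vec n" for v
    using \<mu>_le[of v] that M by (cases "v = 0\<^sub>v n") (auto simp: qN W_def)
  have "det N = 0"
  proof (rule ccontr)
    assume "det N \<noteq> 0"
    then obtain B where B: "B \<in> carrier_mat n n" "B * N = 1\<^sub>m n"
      using det_non_zero_imp_unit[OF N, of "()"] by (auto simp: Units_def ring_mat_def)
    obtain C1 where C1: "C1 > 0"
        "\<And>v. v \<in> carrier_vec n \<Longrightarrow> \<bar>v \<bullet> (N *\<^sub>v v)\<bar> \<le> C1 * (v \<bullet> v)"
      using quadratic_form_bound[OF N] by metis
    have BB: "transpose_mat B * B \<in> carrier_mat n n"
      using B by auto
    obtain C2 where C2: "C2 > 0"
        "\<And>v. v \<in> carrier_vec n \<Longrightarrow> \<bar>v \<bullet> ((transpose_mat B * B) *\<^sub>v v)\<bar> \<le> C2 * (v \<bullet> v)"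
      using quadratic_form_bound[OF BB] by metis
    \<comment> \<open>With \<open>u = N v\<close> and \<open>B\<close> the inverse of
      \<open>N\<close>, the norm of \<open>v = B u\<close> is controlled by that of
      \<open>u\<close>, and the latter by the form of \<open>N\<close> at \<open>v\<close>.\<close>
    have lower: "v \<bullet> v \<le> C2 * (C1 * (v \<bullet> (N *\<^sub>v v)))" if v: "v \<in> carrier_vec n" for v
    proof -
      define u where "u = N *\<^sub>v v"
      have u: "u \<in> carrier_vec n"
        using N v by (auto simp: u_def)
      have "B *\<^sub>v u = v"
        using B N v by (simp add: u_def assoc_mult_mat_vec[symmetric, of B n n N n])
      then have "v \<bullet> v = u \<bullet> ((transpose_mat B * B) *\<^sub>v u)"
        using scalar_prod_transpose_mult_mat_vec[OF B(1) u v] B(1) u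
        by (simp add: assoc_mult_mat_vec[of _ n n _ n])
      also have "\<dots> \<le> C2 * (u \<bullet> u)"
        using C2(2)[OF u] by simp
      also have "u \<bullet> u \<le> C1 * (v \<bullet> u)"
      proof -
        \<comment> \<open>Positivity of the form at \<open>v - t u\<close> replaces diagonalisation;
          \<open>1 / C1\<close> minimises \<open>- 2 * t + C1 * t\<^sup>2\<close>, the factor of
          \<open>u \<bullet> u\<close> in the resulting bound.\<close>
        define t where "t = 1 / C1"
        define w where "w = v - t \<cdot>\<^sub>v u"
        have w: "w \<in> carrier_vec n"
          using u v by (auto simp: w_def)
        have Nw: "N *\<^sub>v w = u - t \<cdot>\<^sub>v (N *\<^sub>v u)"
          using N u v by (simp add: w_def mult_minus_distrib_mat_vec[of _ n n] mult_mat_vec u_def)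
        have vNu: "v \<bullet> (N *\<^sub>v u) = u \<bullet> u"
          using scalar_prod_transpose_mult_mat_vec[OF N v u] Nt by (simp add: u_def)
        have "0 \<le> w \<bullet> (N *\<^sub>v w)"
          by (rule psd[OF w])
        also have "\<dots> = v \<bullet> u - 2 * t * (u \<bullet> u) + t\<^sup>2 * (u \<bullet> (N *\<^sub>v u))"
          unfolding Nw unfolding w_def using N u v vNu
          by (simp add: scalar_prod_minus_distrib[of _ n] minus_scalar_prod_distrib[of _ n]
              power2_eq_square algebra_simps)
        also have "\<dots> \<le> v \<bullet> u - 2 * t * (u \<bullet> u) + t\<^sup>2 * (C1 * (u \<bullet> u))"
          using C1(2)[OF u] by (intro add_left_mono mult_left_mono) auto
        also have "\<dots> = v \<bullet> u - t * (u \<bullet> u)"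
          using C1(1) by (simp add: t_def power2_eq_square)
        finally show ?thesis
          using C1(1) by (simp add: t_def field_simps)
      qed
      finally show ?thesis
        using C2(1) by (simp add: u_def mult_left_mono)
    qed
    have "\<mu> + 1 / (C2 * C1) \<le> Inf (R ` W)"
    proof (rule cINF_greatest)
      show "W \<noteq> {}"
        using f by (auto simp: W_def)
      fix v assume v: "v \<in> W"
      then have "v \<bullet> v \<le> C2 * (C1 * (v \<bullet> (M *\<^sub>v v) - \<mu> * (v \<bullet> v)))"
        using lower[of v] qN[of v] by (auto simp: W_def)
      then show "\<mu> + 1 / (C2 * C1) \<le> R v"
        using pos[OF v] C1(1) C2(1) by (simp add: R_def field_simps)
    qed
    moreover have "1 / (C2 * C1) > 0"
      using C1(1) C2(1) by simp
    ultimately show False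
      by (simp add: \<mu>_def)
  qed
  then obtain v where v: "v \<in> carrier_vec n" "v \<noteq> 0\<^sub>v n" "N *\<^sub>v v = 0\<^sub>v n"
    using det_0_iff_vec_prod_zero[OF N] by blast
  have "M *\<^sub>v v = \<mu> \<cdot>\<^sub>v v"
  proof (rule eq_vecI)
    fix i assume i: "i < dim_vec (\<mu> \<cdot>\<^sub>v v)"
    have "(M *\<^sub>v v - \<mu> \<cdot>\<^sub>v v) $ i = 0"
      using i v Nv[OF v(1)] by simp
    then show "(M *\<^sub>v v) $ i = (\<mu> \<cdot>\<^sub>v v) $ i"
      using i M v by simp
  qed (use M v in auto)
  moreover have "\<mu> * (f \<bullet> f) \<le> f \<bullet> (M *\<^sub>v f)"
    using \<mu>_le[of f] f by (simp add: W_def)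
  ultimately show ?thesis
    using that v by blast
qed

section \<open>The normalized Laplacian and conductance\<close>

definition adj_weight :: "ugraph \<Rightarrow> nat \<Rightarrow> nat \<Rightarrow> real" where
  "adj_weight G u v = (if adjacent G u v then 1 else 0)"

text \<open>The sum runs over ordered pairs, so halving it leaves one term per edge.\<close>

definition dirichlet_form :: "ugraph \<Rightarrow> (nat \<Rightarrow> real) \<Rightarrow> (nat \<Rightarrow> real) \<Rightarrow> real" where
  "dirichlet_form G g h =
     (\<Sum>u\<in>verts G. \<Sum>v\<in>verts G. adj_weight G u v * ((g u - g v) * (h u - h v))) / 2"

definition degree_form :: "ugraph \<Rightarrow> (nat \<Rightarrow> real) \<Rightarrow> (nat \<Rightarrow> real) \<Rightarrow> real" where
  "degree_form G g h = (\<Sum>v\<in>verts G. real (vertex_degree G v) * (g v * h v))"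

text \<open>This is \<open>D^(1/2) g\<close>: the substitution that turns the normalized Laplacian
  into the form of \<open>D - A\<close> and the standard inner product into the degree-weighted
  one.\<close>

definition scaled_vec :: "ugraph \<Rightarrow> (nat \<Rightarrow> real) \<Rightarrow> real Matrix.vec" where
  "scaled_vec G g = Matrix.vec (card (verts G))
     (\<lambda>i. sqrt (real (vertex_degree G (vertex G i))) * g (vertex G i))"

lemma adj_weight_commute: "adj_weight G u v = adj_weight G v u"
  by (simp add: adj_weight_def adjacent_def insert_commute)

lemma vertex_degree_eq_sum:
  "finite (verts G) \<Longrightarrow> real (vertex_degree G u) = (\<Sum>v\<in>verts G. adj_weight G u v)"
  by (simp add: vertex_degree_def adj_weight_def sum.If_cases Int_def)

lemma bij_betw_vertex:
  assumes "finite (verts G)"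
  shows "bij_betw (vertex G) {..<card (verts G)} (verts G)"
  using bij_betw_nth[of "sorted_list_of_set (verts G)" "{..<card (verts G)}" "verts G"] assms
  unfolding vertex_def[abs_def] by simp

lemma sum_vertex:
  assumes "finite (verts G)"
  shows "(\<Sum>i<card (verts G). f (vertex G i)) = (\<Sum>v\<in>verts G. f v)"
  using sum.reindex_bij_betw[OF bij_betw_vertex[OF assms]] .

lemma scaled_vec_carrier [simp]: "scaled_vec G g \<in> carrier_vec (card (verts G))"
  by (simp add: scaled_vec_def)

lemma normalized_laplacian_carrier [simp]:
  "normalized_laplacian G \<in> carrier_mat (card (verts G)) (card (verts G))"
  by (auto simp: normalized_laplacian_def inv_sqrt_degree_matrix_def adjacency_matrix_def
      intro!: mult_carrier_mat minus_carrier_mat)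

lemma normalized_laplacian_index:
  assumes "i < card (verts G)" "j < card (verts G)"
  shows "normalized_laplacian G $$ (i, j) = (if i = j then 1 else 0) -
    adj_weight G (vertex G i) (vertex G j) /
      (sqrt (real (vertex_degree G (vertex G i))) * sqrt (real (vertex_degree G (vertex G j))))"
proof -
  let ?n = "card (verts G)"
  have A: "adjacency_matrix G \<in> carrier_mat ?n ?n"
    by (simp add: adjacency_matrix_def)
  show ?thesis
    unfolding normalized_laplacian_def inv_sqrt_degree_matrix_def mat_diag_mult_left[OF A]
    using assms by (subst mat_diag_mult_right[of _ ?n ?n]) (auto simp: adjacency_matrix_def adj_weight_def)
qed

lemma transpose_normalized_laplacian:
  "transpose_mat (normalized_laplacian G) = normalized_laplacian G"
proof (rule eq_matI)
  fix i j assume "i < dim_row (normalized_laplacian G)" "j < dim_col (normalized_laplacian G)"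
  then have "i < card (verts G)" "j < card (verts G)"
    using normalized_laplacian_carrier[of G] by auto
  then show "transpose_mat (normalized_laplacian G) $$ (i, j) = normalized_laplacian G $$ (i, j)"
    using carrier_matD[OF normalized_laplacian_carrier[of G]]
    by (simp add: normalized_laplacian_index adj_weight_commute[of G "vertex G j" "vertex G i"] mult.commute)
qed (use carrier_matD[OF normalized_laplacian_carrier[of G]] in auto)

lemma scalar_prod_scaled_vec:
  assumes "finite (verts G)"
  shows "scaled_vec G g \<bullet> scaled_vec G h = degree_form G g h"
proof -
  have "scaled_vec G g \<bullet> scaled_vec G h =
      (\<Sum>i<card (verts G). real (vertex_degree G (vertex G i)) * (g (vertex G i) * h (vertex G i)))"
    unfolding scaled_vec_def scalar_prod_def by (simp add: atLeast0LessThan algebra_simps)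
  then show ?thesis
    using sum_vertex[OF assms] by (simp add: degree_form_def)
qed

text \<open>With positive degrees the square roots cancel and the form of \<open>D - A\<close>
  remains. Averaging it with its copy after exchanging the two summations produces the products of
  differences.\<close>

lemma laplacian_scaled_vec:
  assumes fin: "finite (verts G)" and deg: "\<And>v. v \<in> verts G \<Longrightarrow> vertex_degree G v > 0"
  shows "scaled_vec G h \<bullet> (normalized_laplacian G *\<^sub>v scaled_vec G g) = dirichlet_form G h g"
proof -
  let ?n = "card (verts G)"
  let ?U = "verts G"
  let ?x = "vertex G"
  let ?a = "adj_weight G"
  define d where "d v = real (vertex_degree G v)" for v
  have pos: "d v > 0" if "v \<in> ?U" for v
    using deg[OF that] by (simp add: d_def)
  have xU: "?x i \<in> ?U" if "i < ?n" for i
    using bij_betw_vertex[OF fin] that by (auto simp: bij_betw_def)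
  have Lg: "(normalized_laplacian G *\<^sub>v scaled_vec G g) $ i =
      (d (?x i) * g (?x i) - (\<Sum>v\<in>?U. ?a (?x i) v * g v)) / sqrt (d (?x i))" if i: "i < ?n" for i
  proof -
    have "(normalized_laplacian G *\<^sub>v scaled_vec G g) $ i =
       (\<Sum>j<?n. normalized_laplacian G $$ (i, j) * (sqrt (d (?x j)) * g (?x j)))"
      using i carrier_matD[OF normalized_laplacian_carrier[of G]]
      by (simp add: scalar_prod_def scaled_vec_def d_def atLeast0LessThan)
    also have "\<dots> = (\<Sum>j<?n. (if i = j then sqrt (d (?x j)) * g (?x j) else 0) -
        ?a (?x i) (?x j) * g (?x j) / sqrt (d (?x i)))"
    proof (rule sum.cong)
      fix j assume "j \<in> {..<?n}"
      then have j: "j < ?n" by simp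
      show "normalized_laplacian G $$ (i, j) * (sqrt (d (?x j)) * g (?x j)) =
          (if i = j then sqrt (d (?x j)) * g (?x j) else 0) -
            ?a (?x i) (?x j) * g (?x j) / sqrt (d (?x i))"
        unfolding normalized_laplacian_index[OF i j] d_def[symmetric]
        using pos[OF xU[OF i]] pos[OF xU[OF j]] by (auto simp: field_simps)
    qed simp
    also have "\<dots> = sqrt (d (?x i)) * g (?x i) -
        (\<Sum>j<?n. ?a (?x i) (?x j) * g (?x j) / sqrt (d (?x i)))"
      using i by (simp add: sum_subtractf)
    also have "(\<Sum>j<?n. ?a (?x i) (?x j) * g (?x j) / sqrt (d (?x i))) =
        (\<Sum>v\<in>?U. ?a (?x i) v * g v) / sqrt (d (?x i))"
      using sum_vertex[OF fin, of "\<lambda>v. ?a (?x i) v * g v / sqrt (d (?x i))"]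
      by (simp add: sum_divide_distrib)
    finally show ?thesis
      using pos[OF xU[OF i]] by (simp add: field_simps)
  qed
  have "scaled_vec G h \<bullet> (normalized_laplacian G *\<^sub>v scaled_vec G g) =
      (\<Sum>i<?n. sqrt (d (?x i)) * h (?x i) * (normalized_laplacian G *\<^sub>v scaled_vec G g) $ i)"
    using carrier_matD[OF normalized_laplacian_carrier[of G]]
    by (simp add: scalar_prod_def scaled_vec_def d_def atLeast0LessThan)
  also have "\<dots> = (\<Sum>i<?n. h (?x i) * (d (?x i) * g (?x i) - (\<Sum>v\<in>?U. ?a (?x i) v * g v)))"
    using pos xU by (intro sum.cong) (force simp: Lg field_simps)+
  also have "\<dots> = (\<Sum>u\<in>?U. h u * (d u * g u - (\<Sum>v\<in>?U. ?a u v * g v)))"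
    by (rule sum_vertex[OF fin])
  also have "\<dots> = (\<Sum>u\<in>?U. \<Sum>v\<in>?U. ?a u v * (h u * g u - h u * g v))"
    using fin by (simp add: d_def vertex_degree_eq_sum sum_distrib_left sum_distrib_right
        sum_subtractf algebra_simps)
  also have "\<dots> = dirichlet_form G h g"
  proof -
    let ?s = "\<Sum>u\<in>?U. \<Sum>v\<in>?U. ?a u v * (h u * g u - h u * g v)"
    have "?s = (\<Sum>u\<in>?U. \<Sum>v\<in>?U. ?a u v * (h v * g v - h v * g u))"
      by (subst sum.swap) (simp add: adj_weight_commute)
    then have "2 * ?s = ?s + (\<Sum>u\<in>?U. \<Sum>v\<in>?U. ?a u v * (h v * g v - h v * g u))"
      by simp
    also have "\<dots> = (\<Sum>u\<in>?U. \<Sum>v\<in>?U. ?a u v * ((h u - h v) * (g u - g v)))"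
      by (simp add: sum.distrib[symmetric] algebra_simps)
    finally show ?thesis
      by (simp add: dirichlet_form_def)
  qed
  finally show ?thesis .
qed

text \<open>A vanishing sum of non-negative terms forces equality across each edge, hence along
  paths. In a connected graph the kernel of the Laplacian is therefore spanned by
  \<open>D^(1/2) 1\<close>.\<close>

lemma dirichlet_form_eq_0_imp_constant:
  assumes fin: "finite (verts G)"
    and sub: "\<Union>(edges G) \<subseteq> verts G"
    and zero: "dirichlet_form G g g = 0"
    and reach: "(adjacent G)\<^sup>*\<^sup>* u v"
  shows "g u = g v"
  using reach
proof (induction rule: rtranclp_induct)
  case (step y z)
  have nonneg: "adj_weight G u v * ((g u - g v) * (g u - g v)) \<ge> 0" for u v
    by (simp add: adj_weight_def)
  have "y \<in> verts G" "z \<in> verts G"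
    using step.hyps(2) sub by (auto simp: adjacent_def)
  moreover have "(\<Sum>u\<in>verts G. \<Sum>v\<in>verts G. adj_weight G u v * ((g u - g v) * (g u - g v))) = 0"
    using zero by (simp add: dirichlet_form_def)
  ultimately have "adj_weight G y z * ((g y - g z) * (g y - g z)) = 0"
    using fin nonneg by (simp add: sum_nonneg_eq_0_iff sum_nonneg)
  then show ?case
    using step by (simp add: adj_weight_def)
qed simp

text \<open>The rank-one term \<open>t w w\<^sup>T\<close>, with \<open>w = D\<^sup>1\<^sup>/\<^sup>2 1\<close>, shifts the eigenvalue 0 of the Laplacian above
  \<open>r\<close> and leaves the form unchanged on the orthogonal complement of \<open>w\<close>.\<close>

lemma lambda1_le_rayleigh:
  assumes fin: "finite (verts G)" and sub: "\<Union>(edges G) \<subseteq> verts G"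
    and conn: "\<And>u v. u \<in> verts G \<Longrightarrow> v \<in> verts G \<Longrightarrow> (adjacent G)\<^sup>*\<^sup>* u v"
    and deg: "\<And>v. v \<in> verts G \<Longrightarrow> vertex_degree G v > 0"
    and orth: "degree_form G (\<lambda>_. 1) g = 0"
    and pos: "degree_form G g g > 0"
    and le: "dirichlet_form G g g \<le> r * degree_form G g g"
  shows "lambda1 G \<le> r"
proof -
  define n where "n = card (verts G)"
  define L where "L = normalized_laplacian G"
  define w where "w = scaled_vec G (\<lambda>_. 1)"
  define f where "f = scaled_vec G g"
  \<comment> \<open>The shifted matrix has eigenvalue \<open>t * (w \<bullet> w)\<close> at
    \<open>w\<close>. Since \<open>w \<bullet> w\<close> is the total degree, at least 1, this value
    of \<open>t\<close> lifts it above \<open>r\<close>.\<close>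
  define t where "t = \<bar>r\<bar> + 1"
  define P where "P = Matrix.mat n n (\<lambda>(i, j). t * (w $ i * w $ j))"
  have L: "L \<in> carrier_mat n n" and w: "w \<in> carrier_vec n" and f: "f \<in> carrier_vec n"
    and P: "P \<in> carrier_mat n n"
    by (simp_all add: L_def n_def w_def f_def P_def)
  have Lt: "transpose_mat L = L"
    by (simp add: L_def transpose_normalized_laplacian)
  have Pv: "P *\<^sub>v v = (t * (w \<bullet> v)) \<cdot>\<^sub>v w" if "v \<in> carrier_vec n" for v
    using that w by (intro eq_vecI)
      (auto simp: P_def scalar_prod_def sum_distrib_left sum_distrib_right algebra_simps)
  have M: "L + P \<in> carrier_mat n n"
    using L P by simp
  have Mt: "transpose_mat (L + P) = L + P"
  proof -
    have "transpose_mat P = P"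
      by (rule eq_matI) (auto simp: P_def)
    then show ?thesis
      using transpose_add[OF L P] Lt by simp
  qed
  have Mv: "(L + P) *\<^sub>v v = L *\<^sub>v v + (t * (w \<bullet> v)) \<cdot>\<^sub>v w" if "v \<in> carrier_vec n" for v
    using add_mult_distrib_mat_vec[OF L P that] Pv[OF that] by simp
  have wf: "w \<bullet> f = 0"
    using orth fin by (simp add: w_def f_def scalar_prod_scaled_vec)
  have ff: "f \<bullet> f > 0"
    using pos fin by (simp add: f_def scalar_prod_scaled_vec)
  then have f0: "f \<noteq> 0\<^sub>v n"
    using f by auto
  obtain v \<mu> where v: "v \<in> carrier_vec n" "v \<noteq> 0\<^sub>v n" "(L + P) *\<^sub>v v = \<mu> \<cdot>\<^sub>v v"
      "\<mu> * (f \<bullet> f) \<le> f \<bullet> ((L + P) *\<^sub>v f)"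
    using symmetric_eigenvector_le_rayleigh[OF M Mt f f0] by metis
  have "f \<bullet> ((L + P) *\<^sub>v f) = f \<bullet> (L *\<^sub>v f)"
    using f w L wf by (simp add: Mv scalar_prod_add_distrib[of _ n] comm_scalar_prod[of f n w])
  also have "\<dots> \<le> r * (f \<bullet> f)"
    using le by (simp add: f_def L_def laplacian_scaled_vec[OF fin deg] scalar_prod_scaled_vec[OF fin])
  finally have \<mu>r: "\<mu> \<le> r"
    using v(4) ff by (meson mult_le_cancel_right order_trans not_less)
  \<comment> \<open>As no degree vanishes, \<open>D^(1/2)\<close> is invertible and every vector has
    this form.\<close>
  obtain h where h: "v = scaled_vec G h"
  proof
    define x where "x = inv_into {..<n} (vertex G)"
    have x: "x (vertex G i) = i" if "i < n" for i
      using that bij_betw_vertex[OF fin] by (simp add: x_def n_def bij_betw_def inv_into_f_f)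
    show "v = scaled_vec G (\<lambda>u. v $ x u / sqrt (real (vertex_degree G u)))"
    proof (rule eq_vecI)
      fix i assume "i < dim_vec (scaled_vec G (\<lambda>u. v $ x u / sqrt (real (vertex_degree G u))))"
      then have i: "i < n"
        by (simp add: scaled_vec_def n_def)
      then have "vertex_degree G (vertex G i) > 0"
        using deg bij_betw_vertex[OF fin] by (auto simp: bij_betw_def n_def)
      then show "v $ i = scaled_vec G (\<lambda>u. v $ x u / sqrt (real (vertex_degree G u))) $ i"
        using i x[OF i] by (simp add: scaled_vec_def n_def)
    qed (use v(1) in \<open>simp add: scaled_vec_def n_def\<close>)
  qed
  \<comment> \<open>Pairing the eigenvalue equation with \<open>w\<close> kills the Laplacian term
    and leaves \<open>(t * (w \<bullet> w) - \<mu>) * (w \<bullet> v) = 0\<close>, whose first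
    factor is positive.\<close>
  have "w \<bullet> (L *\<^sub>v v) = 0"
    by (simp add: w_def h L_def laplacian_scaled_vec[OF fin deg] dirichlet_form_def)
  then have "t * (w \<bullet> w) * (w \<bullet> v) = \<mu> * (w \<bullet> v)"
    using arg_cong[OF v(3), of "\<lambda>x. w \<bullet> x"] v(1) w L
    by (simp add: Mv scalar_prod_add_distrib[of _ n])
  moreover have "\<mu> < t * (w \<bullet> w)"
  proof -
    have "verts G \<noteq> {}"
      using pos by (auto simp: degree_form_def)
    then obtain u where u: "u \<in> verts G"
      by blast
    have "1 \<le> real (vertex_degree G u)"
      using deg[OF u] by simp
    also have "\<dots> \<le> w \<bullet> w"
      unfolding w_def scalar_prod_scaled_vec[OF fin] degree_form_def
      using fin u by (intro order_trans[OF _ member_le_sum[of u]]) auto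
    finally have "t * 1 \<le> t * (w \<bullet> w)"
      by (intro mult_left_mono) (auto simp: t_def)
    then show ?thesis
      using \<mu>r by (simp add: t_def)
  qed
  ultimately have wv: "w \<bullet> v = 0"
    by simp
  then have Lv: "L *\<^sub>v v = \<mu> \<cdot>\<^sub>v v"
  proof -
    have "0 \<cdot>\<^sub>v w = 0\<^sub>v n"
      using w by (intro eq_vecI) auto
    then show ?thesis
      using v(3) Mv[OF v(1)] wv L v(1) by simp
  qed
  \<comment> \<open>Otherwise \<open>h\<close> would be constant and \<open>v\<close> a multiple of
    \<open>w\<close>, although \<open>v\<close> is non-zero and orthogonal to
    \<open>w\<close>.\<close>
  have "\<mu> \<noteq> 0"
  proof
    assume "\<mu> = 0"
    then have "dirichlet_form G h h = 0"
      using Lv v(1) laplacian_scaled_vec[OF fin deg, of h h] by (simp add: h L_def)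
    then have const: "h a = h b" if "a \<in> verts G" "b \<in> verts G" for a b
      using dirichlet_form_eq_0_imp_constant[OF fin sub _ conn[OF that]] by blast
    have "v \<bullet> v = 0"
    proof (cases "verts G = {}")
      case False
      then obtain b where b: "b \<in> verts G" by blast
      have "degree_form G h h = h b * degree_form G (\<lambda>_. 1) h"
        unfolding degree_form_def sum_distrib_left
        by (intro sum.cong) (auto simp: const[OF _ b] algebra_simps)
      then show ?thesis
        using wv by (simp add: h w_def scalar_prod_scaled_vec[OF fin])
    qed (simp add: h scalar_prod_scaled_vec[OF fin] degree_form_def)
    then show False
      using scalar_prod_self_pos[OF v(1,2)] by simp
  qed
  moreover have "\<mu> \<in> spectrum L"
    using v(1,2) Lv L by (auto simp: spectrum_def eigenvalue_def eigenvector_def)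
  ultimately have "lambda1 G \<le> \<mu>"
    unfolding lambda1_def L_def[symmetric] using card_finite_spectrum(1)[OF L]
    by (intro Min_le) auto
  then show ?thesis
    using \<mu>r by simp
qed

text \<open>The test function is \<open>B\<close> on \<open>S\<close> and \<open>- A\<close>
  elsewhere, with \<open>A\<close>, \<open>B\<close> the volumes of \<open>S\<close> and its
  complement; this choice makes it orthogonal to constants. With \<open>q\<close> edges in the cut,
  its energy is \<open>q * (A + B)\<^sup>2\<close> and its norm \<open>A * B * (A + B)\<close>, so
  the quotient is \<open>q * (1 / A + 1 / B)\<close>.\<close>

lemma lambda1_le_conductance:
  assumes fin: "finite (verts G)" and sub: "\<Union>(edges G) \<subseteq> verts G"
    and conn: "\<And>u v. u \<in> verts G \<Longrightarrow> v \<in> verts G \<Longrightarrow> (adjacent G)\<^sup>*\<^sup>* u v"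
    and deg: "\<And>v. v \<in> verts G \<Longrightarrow> vertex_degree G v > 0"
    and S: "S \<subseteq> verts G"
    and a: "(\<Sum>v\<in>S. real (vertex_degree G v)) \<ge> a" "a > 0"
    and b: "(\<Sum>v\<in>verts G - S. real (vertex_degree G v)) \<ge> b" "b > 0"
    and cut: "(\<Sum>u\<in>S. \<Sum>v\<in>verts G - S. adj_weight G u v) \<le> k"
  shows "lambda1 G \<le> k * (1 / a + 1 / b)"
proof -
  let ?T = "verts G - S"
  define d where "d v = real (vertex_degree G v)" for v
  define A where "A = (\<Sum>v\<in>S. d v)"
  define B where "B = (\<Sum>v\<in>?T. d v)"
  define q where "q = (\<Sum>u\<in>S. \<Sum>v\<in>?T. adj_weight G u v)"
  define g where "g v = (if v \<in> S then B else - A)" for v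
  have A: "A \<ge> a" "A > 0" and B: "B \<ge> b" "B > 0"
    using a b by (simp_all add: A_def B_def d_def)
  have q0: "0 \<le> q"
    by (simp add: q_def adj_weight_def sum_nonneg)
  have qk: "q \<le> k"
    using cut by (simp add: q_def)
  have split: "(\<Sum>v\<in>verts G. f v) = (\<Sum>v\<in>S. f v) + (\<Sum>v\<in>?T. f v)" for f :: "nat \<Rightarrow> real"
    using sum.subset_diff[OF S fin, of f] by simp
  have gS: "(\<Sum>v\<in>S. f v (g v)) = (\<Sum>v\<in>S. f v B)" for f :: "nat \<Rightarrow> real \<Rightarrow> real"
    by (simp add: g_def)
  have gT: "(\<Sum>v\<in>?T. f v (g v)) = (\<Sum>v\<in>?T. f v (- A))" for f :: "nat \<Rightarrow> real \<Rightarrow> real"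
    by (intro sum.cong) (auto simp: g_def)
  have orth: "degree_form G (\<lambda>_. 1) g = 0"
    unfolding degree_form_def d_def[symmetric] split
    using gS[of "\<lambda>v x. d v * x"] gT[of "\<lambda>v x. d v * x"]
    by (simp add: A_def B_def sum_distrib_right[symmetric] sum_negf)
  have form: "degree_form G g g = A * B\<^sup>2 + B * A\<^sup>2"
    unfolding degree_form_def d_def[symmetric] split
    using gS[of "\<lambda>v x. d v * (x * x)"] gT[of "\<lambda>v x. d v * (x * x)"]
    by (simp add: A_def B_def sum_distrib_right[symmetric] power2_eq_square)
  have q_TS: "q = (\<Sum>v\<in>?T. \<Sum>u\<in>S. adj_weight G v u)"
    unfolding q_def by (subst sum.swap) (simp add: adj_weight_commute)
  have TS: "(\<Sum>v\<in>?T. \<Sum>u\<in>S. adj_weight G v u * ((g v - g u) * (g v - g u))) = q * (A + B)\<^sup>2"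
    unfolding q_TS sum_distrib_right
    by (intro sum.cong refl) (auto simp: g_def power2_eq_square algebra_simps)
  have ST: "(\<Sum>u\<in>S. \<Sum>v\<in>?T. adj_weight G u v * ((g u - g v) * (g u - g v))) = q * (A + B)\<^sup>2"
    unfolding q_def sum_distrib_right
    by (intro sum.cong refl) (auto simp: g_def power2_eq_square algebra_simps)
  have SS: "(\<Sum>u\<in>S. \<Sum>v\<in>S. adj_weight G u v * ((g u - g v) * (g u - g v))) = 0"
    by (simp add: g_def)
  have TT: "(\<Sum>u\<in>?T. \<Sum>v\<in>?T. adj_weight G u v * ((g u - g v) * (g u - g v))) = 0"
    by (auto simp: g_def intro!: sum.neutral)
  have dir: "dirichlet_form G g g = q * (A + B)\<^sup>2"
    unfolding dirichlet_form_def split by (simp add: sum.distrib SS ST TS TT)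
  have "lambda1 G \<le> q * (1 / A + 1 / B)"
  proof (rule lambda1_le_rayleigh[OF fin sub conn deg orth])
    show "degree_form G g g > 0"
      using A B by (simp add: form add_pos_pos)
    show "dirichlet_form G g g \<le> q * (1 / A + 1 / B) * degree_form G g g"
      using A(2) B(2) unfolding dir form by (simp add: field_simps power2_eq_square)
  qed
  also have "\<dots> \<le> k * (1 / a + 1 / b)"
    using A B a(2) b(2) q0 qk by (intro mult_mono add_mono frac_le) auto
  finally show ?thesis .
qed

section \<open>Random graphs and switching\<close>

lemma finite_vertex_pairs [simp]: "finite (vertex_pairs n)"
  by (rule finite_subset[of _ "Pow {..<n}"]) (auto simp: vertex_pairs_def)

lemma set_pmf_gnp:
  assumes "0 < p" "p < 1"
  shows "set_pmf (gnp n p) = {({..<n}, E) | E. E \<subseteq> vertex_pairs n}"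
proof -
  have "set_pmf (Pi_pmf (vertex_pairs n) False (\<lambda>_. bernoulli_pmf p)) = {x. \<forall>e. x e \<longrightarrow> e \<in> vertex_pairs n}"
    using assms by (auto simp: set_Pi_pmf PiE_dflt_def)
  moreover have "({..<n}, E) = (\<lambda>x. ({..<n}, {e \<in> vertex_pairs n. x e})) (\<lambda>e. e \<in> E)"
    if "E \<subseteq> vertex_pairs n" for E
    using that by auto
  ultimately show ?thesis
    by (auto simp: gnp_def image_iff Bex_def)
qed

lemma pmf_gnp:
  assumes "0 < p" "p < 1" and E: "E \<subseteq> vertex_pairs n"
  shows "pmf (gnp n p) ({..<n}, E) = p ^ card E * (1 - p) ^ card (vertex_pairs n - E)"
proof -
  let ?W = "vertex_pairs n"
  let ?M = "Pi_pmf ?W False (\<lambda>_. bernoulli_pmf p)"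
  let ?f = "\<lambda>x. ({..<n}, {e \<in> ?W. x e})"
  have set: "set_pmf ?M = {x. \<forall>e. x e \<longrightarrow> e \<in> ?W}"
    using assms by (auto simp: set_Pi_pmf PiE_dflt_def)
  have "inj_on ?f (set_pmf ?M)"
    unfolding set by (rule inj_onI) (auto simp: fun_eq_iff)
  then have "pmf (map_pmf ?f ?M) (?f (\<lambda>e. e \<in> E)) = pmf ?M (\<lambda>e. e \<in> E)"
    by (rule pmf_map_inj) (use E set in auto)
  also have "?f (\<lambda>e. e \<in> E) = ({..<n}, E)"
    using E by auto
  also have "pmf ?M (\<lambda>e. e \<in> E) = (\<Prod>e\<in>?W. pmf (bernoulli_pmf p) (e \<in> E))"
    using E by (intro pmf_Pi') auto
  also have "\<dots> = (\<Prod>e\<in>?W. if e \<in> E then p else 1 - p)"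
    using assms by (intro prod.cong) auto
  also have "\<dots> = p ^ card E * (1 - p) ^ card (?W - E)"
    using E by (simp add: prod.If_cases Int_absorb1 Diff_eq)
  finally show ?thesis
    by (simp add: gnp_def)
qed

text \<open>The exact ratio of the weights is \<open>(p / (1 - p)) ^ m\<close>; dropping the
  denominator only weakens the bound.\<close>

lemma pmf_gnp_add_edges:
  assumes p: "0 < p" "p < 1" and E: "E \<subseteq> vertex_pairs n"
    and F: "F \<subseteq> vertex_pairs n - E" "card F = m"
  shows "p ^ m * pmf (gnp n p) ({..<n}, E) \<le> pmf (gnp n p) ({..<n}, E \<union> F)"
proof -
  let ?W = "vertex_pairs n"
  have fin: "finite E" "finite F"
    using E F finite_vertex_pairs[of n] by (auto intro: finite_subset)
  have EF: "E \<union> F \<subseteq> ?W"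
    using E F by auto
  have "E \<inter> F = {}"
    using F by auto
  then have "card (E \<union> F) = card E + m"
    using fin F by (simp add: card_Un_disjoint)
  moreover have "(1 - p) ^ card (?W - E) \<le> (1 - p) ^ card (?W - (E \<union> F))"
    using p by (intro power_decreasing card_mono) auto
  ultimately have "p ^ m * (p ^ card E * (1 - p) ^ card (?W - E))
      \<le> p ^ card (E \<union> F) * (1 - p) ^ card (?W - (E \<union> F))"
    using p mult_left_mono[of "(1 - p) ^ card (?W - E)" _ "p ^ card E * p ^ m"]
    by (simp add: power_add mult_ac)
  then show ?thesis
    by (simp add: pmf_gnp[OF p E] pmf_gnp[OF p EF])
qed

text \<open>Double counting: by injectivity the images carry total weight at most 1, while each
  \<open>x\<close> in \<open>A\<close> sends out at least \<open>a\<close> images, each of weight at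
  least \<open>\<rho> * pmf M x\<close>.\<close>

lemma switching_bound:
  fixes M :: "'a pmf"
  assumes fin: "finite A" "\<And>x. x \<in> A \<Longrightarrow> finite (R x)"
    and inj: "inj_on (\<lambda>(x, l). f x l) (SIGMA x:A. R x)"
    and weight: "\<And>x l. x \<in> A \<Longrightarrow> l \<in> R x \<Longrightarrow> \<rho> * pmf M x \<le> pmf M (f x l)"
    and count: "\<And>x. x \<in> A \<Longrightarrow> a \<le> real (card (R x))"
    and "\<rho> \<ge> 0"
  shows "measure_pmf.prob M A * (a * \<rho>) \<le> 1"
proof -
  have "measure_pmf.prob M A * (a * \<rho>) = (\<Sum>x\<in>A. a * (\<rho> * pmf M x))"
    using fin by (simp add: measure_measure_pmf_finite sum_distrib_left algebra_simps)
  also have "\<dots> \<le> (\<Sum>x\<in>A. real (card (R x)) * (\<rho> * pmf M x))"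
    using \<open>\<rho> \<ge> 0\<close> count by (intro sum_mono mult_right_mono) auto
  also have "\<dots> \<le> (\<Sum>x\<in>A. \<Sum>l\<in>R x. pmf M (f x l))"
  proof (rule sum_mono)
    fix x assume "x \<in> A"
    then show "real (card (R x)) * (\<rho> * pmf M x) \<le> (\<Sum>l\<in>R x. pmf M (f x l))"
      using sum_mono[of "R x" "\<lambda>_. \<rho> * pmf M x" "\<lambda>l. pmf M (f x l)"] weight by simp
  qed
  also have "\<dots> = (\<Sum>(x, l)\<in>(SIGMA x:A. R x). pmf M (f x l))"
    using fin by (intro sum.Sigma) auto
  also have "\<dots> = (\<Sum>y\<in>(\<lambda>(x, l). f x l) ` (SIGMA x:A. R x). pmf M y)"
    by (subst sum.reindex[OF inj]) (simp add: case_prod_unfold)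
  also have "\<dots> = measure_pmf.prob M ((\<lambda>(x, l). f x l) ` (SIGMA x:A. R x))"
    using fin by (intro measure_measure_pmf_finite[symmetric]) auto
  also have "\<dots> \<le> 1"
    by simp
  finally show ?thesis .
qed

section \<open>Second moment of the number of isolated vertices\<close>

definition isolated_vertices :: "ugraph \<Rightarrow> nat set" where
  "isolated_vertices G = {v \<in> verts G. v \<notin> \<Union>(edges G)}"

text \<open>The event says that each pair meeting \<open>U\<close> is absent, and these pairs are
  independent.\<close>

lemma prob_gnp_subset_isolated:
  assumes p: "0 < p" "p < 1" and U: "U \<subseteq> {..<n}"
  shows "measure_pmf.prob (gnp n p) {G. U \<subseteq> isolated_vertices G}
    = (1 - p) ^ card {e \<in> vertex_pairs n. e \<inter> U \<noteq> {}}"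
proof -
  let ?W = "vertex_pairs n"
  let ?M = "Pi_pmf ?W False (\<lambda>_. bernoulli_pmf p)"
  let ?f = "\<lambda>x. ({..<n}, {e \<in> ?W. x e})"
  define B :: "nat set \<Rightarrow> bool set" where "B e = (if e \<inter> U \<noteq> {} then {False} else UNIV)" for e
  have "measure_pmf.prob (gnp n p) {G. U \<subseteq> isolated_vertices G} =
      measure_pmf.prob ?M (?f -` {G. U \<subseteq> isolated_vertices G})"
    by (simp add: gnp_def)
  \<comment> \<open>The two events differ only by functions that are true somewhere outside
    \<open>vertex_pairs n\<close>, which have mass 0.\<close>
  also have "\<dots> = measure_pmf.prob ?M (PiE_dflt ?W False B)"
  proof (rule measure_prob_cong_0)
    fix x assume "x \<in> ?f -` {G. U \<subseteq> isolated_vertices G} - PiE_dflt ?W False B"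
    then have "\<exists>e. e \<notin> ?W \<and> x e \<noteq> False"
      by (auto simp: isolated_vertices_def PiE_dflt_def B_def split: if_splits)
    then show "pmf ?M x = 0"
      by (intro pmf_Pi_outside) auto
  next
    fix x assume x: "x \<in> PiE_dflt ?W False B - ?f -` {G. U \<subseteq> isolated_vertices G}"
    then have *: "\<And>e. e \<in> ?W \<Longrightarrow> x e \<in> B e"
      by (auto simp: PiE_dflt_def)
    have "U \<subseteq> isolated_vertices (?f x)"
    proof
      fix u assume u: "u \<in> U"
      have "\<not> x e" if "e \<in> ?W" "u \<in> e" for e
        using *[OF that(1)] that(2) u by (auto simp: B_def split: if_splits)
      then show "u \<in> isolated_vertices (?f x)"
        using u U by (auto simp: isolated_vertices_def)
    qed
    then show "pmf ?M x = 0"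
      using x by auto
  qed
  also have "\<dots> = (\<Prod>e\<in>?W. measure_pmf.prob (bernoulli_pmf p) (B e))"
    by (rule measure_Pi_pmf_PiE_dflt) simp
  also have "\<dots> = (\<Prod>e\<in>?W. if e \<inter> U \<noteq> {} then 1 - p else 1)"
    using p by (intro prod.cong) (auto simp: B_def measure_pmf_single)
  also have "\<dots> = (1 - p) ^ card {e \<in> ?W. e \<inter> U \<noteq> {}}"
    by (simp add: prod.If_cases Int_def)
  finally show ?thesis .
qed

lemma card_vertex_pairs_at_vertex:
  assumes "u < n"
  shows "card {e \<in> vertex_pairs n. u \<in> e} = n - 1"
proof -
  have "{e \<in> vertex_pairs n. u \<in> e} = (\<lambda>w. {u, w}) ` ({..<n} - {u})"
    using assms by (auto simp: vertex_pairs_def card_2_iff image_iff)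
  moreover have "inj_on (\<lambda>w. {u, w}) ({..<n} - {u})"
    by (auto simp: inj_on_def doubleton_eq_iff)
  ultimately show ?thesis
    using assms by (simp add: card_image)
qed

text \<open>Inclusion and exclusion: the only pair counted twice is \<open>{u, v}\<close>, hence
  \<open>2 * (n - 1) - 1\<close>.\<close>

lemma card_vertex_pairs_at_two_vertices:
  assumes "u < n" "v < n" "u \<noteq> v"
  shows "card {e \<in> vertex_pairs n. u \<in> e \<or> v \<in> e} = 2 * n - 3"
proof -
  let ?T = "\<lambda>u. {e \<in> vertex_pairs n. u \<in> e}"
  have "?T u \<inter> ?T v = {{u, v}}"
    using assms by (auto simp: vertex_pairs_def card_2_iff)
  moreover have "card (?T u \<union> ?T v) + card (?T u \<inter> ?T v) = card (?T u) + card (?T v)"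
    by (rule card_Un_Int[symmetric]) auto
  moreover have "?T u \<union> ?T v = {e \<in> vertex_pairs n. u \<in> e \<or> v \<in> e}"
    by auto
  ultimately show ?thesis
    using assms by (simp add: card_vertex_pairs_at_vertex)
qed

text \<open>The isolation events of two vertices share a single pair, so their covariance is at most
  \<open>p\<close>. This keeps the variance below \<open>n + n\<^sup>2 * p\<close>, which is linear
  in n for \<open>p = c / n\<close>. The mean is at least \<open>2 * t\<close>, so a count below
  \<open>t\<close> deviates from it by at least \<open>t\<close>.\<close>

lemma prob_few_isolated_vertices_le:
  assumes p: "0 < p" "p < 1" and n: "n \<ge> 2"
    and t: "t > 0" "2 * t \<le> real n * (1 - p) ^ (n - 1)"
  shows "measure_pmf.prob (gnp n p) {G. real (card (isolated_vertices G)) < t}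
    \<le> (real n + (real n)\<^sup>2 * p) / t\<^sup>2"
proof -
  let ?M = "gnp n p"
  let ?q = "1 - p"
  define X where "X v G = (indicator {G. v \<in> isolated_vertices G} G :: real)" for v G
  define N where "N G = (\<Sum>v<n. X v G)" for G
  have fin: "finite (set_pmf ?M)"
    unfolding set_pmf_gnp[OF p] by (simp add: setcompr_eq_image)
  note int = integrable_measure_pmf_finite[OF fin]
  have N: "N G = real (card (isolated_vertices G))" if "G \<in> set_pmf ?M" for G
  proof -
    have "verts G = {..<n}"
      using that by (auto simp: set_pmf_gnp[OF p])
    then have "isolated_vertices G = {v \<in> {..<n}. v \<in> isolated_vertices G}"
      by (auto simp: isolated_vertices_def)
    then show ?thesis
      by (simp add: N_def X_def indicator_def sum.If_cases Int_def)
  qed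
  have EX: "measure_pmf.expectation ?M (X v) = ?q ^ (n - 1)" if "v < n" for v
    using prob_gnp_subset_isolated[OF p, of "{v}" n] card_vertex_pairs_at_vertex[OF that] that
    by (simp add: X_def[abs_def])
  have EN: "measure_pmf.expectation ?M N = real n * ?q ^ (n - 1)"
    unfolding N_def[abs_def] by (subst Bochner_Integration.integral_sum) (auto simp: EX int)
  have EXX: "measure_pmf.expectation ?M (\<lambda>G. X u G * X v G) \<le> (if u = v then 1 else ?q ^ (2 * n - 3))"
    if "u < n" "v < n" for u v
  proof -
    have XX: "(\<lambda>G. X u G * X v G) = indicator {G. {u, v} \<subseteq> isolated_vertices G}"
      by (auto simp: X_def indicator_def fun_eq_iff)
    show ?thesis
    proof (cases "u = v")
      case False
      then show ?thesis
        unfolding XX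
        using prob_gnp_subset_isolated[OF p, of "{u, v}" n] that
          card_vertex_pairs_at_two_vertices[OF that False]
        by simp
    next
      case True
      then show ?thesis
        unfolding XX by simp
    qed
  qed
  have "measure_pmf.expectation ?M (\<lambda>G. (N G)\<^sup>2) =
      (\<Sum>u<n. \<Sum>v<n. measure_pmf.expectation ?M (\<lambda>G. X u G * X v G))"
    unfolding N_def power2_eq_square sum_product
    by (subst Bochner_Integration.integral_sum; intro sum.cong refl int)
      (subst Bochner_Integration.integral_sum; intro sum.cong refl int)
  also have "\<dots> \<le> (\<Sum>u<n. \<Sum>v<n. (if u = v then 1 else 0) + ?q ^ (2 * n - 3))"
  proof (intro sum_mono)
    fix u v assume "u \<in> {..<n}" "v \<in> {..<n}"
    then have "measure_pmf.expectation ?M (\<lambda>G. X u G * X v G) \<le> (if u = v then 1 else ?q ^ (2 * n - 3))"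
      using EXX by simp
    also have "\<dots> \<le> (if u = v then 1 else 0) + ?q ^ (2 * n - 3)"
      using p by simp
    finally show "measure_pmf.expectation ?M (\<lambda>G. X u G * X v G) \<le> \<dots>" .
  qed
  also have "\<dots> = real n + (real n)\<^sup>2 * ?q ^ (2 * n - 3)"
    by (simp add: sum.distrib power2_eq_square distrib_left)
  finally have EN2: "measure_pmf.expectation ?M (\<lambda>G. (N G)\<^sup>2) \<le> \<dots>" .
  have "(?q ^ (n - 1))\<^sup>2 = ?q ^ (2 * n - 3) * ?q"
  proof -
    have "(n - 1) * 2 = Suc (2 * n - 3)"
      using n by linarith
    then show ?thesis
      by (simp only: power_mult[symmetric] power_Suc2)
  qed
  then have "measure_pmf.variance ?M N =
      measure_pmf.expectation ?M (\<lambda>G. (N G)\<^sup>2) - (real n)\<^sup>2 * (?q ^ (2 * n - 3) * ?q)"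
    using measure_pmf.variance_eq[OF int int, of N] by (simp add: EN power_mult_distrib)
  also have "\<dots> \<le> real n + (real n)\<^sup>2 * (?q ^ (2 * n - 3) * p)"
    using EN2 by (simp add: algebra_simps)
  also have "\<dots> \<le> real n + (real n)\<^sup>2 * (1 * p)"
    using p by (intro add_left_mono mult_left_mono mult_right_mono power_le_one) auto
  finally have var: "measure_pmf.variance ?M N \<le> real n + (real n)\<^sup>2 * p"
    by simp
  have "measure_pmf.prob ?M {G. real (card (isolated_vertices G)) < t} =
      measure_pmf.prob ?M ({G. real (card (isolated_vertices G)) < t} \<inter> set_pmf ?M)"
    by (simp add: measure_Int_set_pmf)
  also have "\<dots> \<le> measure_pmf.prob ?M {G \<in> space ?M. t \<le> \<bar>N G - measure_pmf.expectation ?M N\<bar>}"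
    using t by (intro measure_pmf.finite_measure_mono) (auto simp: EN N[symmetric])
  also have "\<dots> \<le> measure_pmf.variance ?M N / t\<^sup>2"
    using t int by (intro measure_pmf.Chebyshev_inequality) auto
  also have "\<dots> \<le> (real n + (real n)\<^sup>2 * p) / t\<^sup>2"
    using var t by (intro divide_right_mono) auto
  finally show ?thesis .
qed

text \<open>The mean is asymptotic to \<open>exp (- c) * n\<close>. One factor 1/2 in the threshold
  absorbs the convergence, the other one leaves the deviation for Chebyshev's inequality.\<close>

lemma prob_few_isolated_vertices_tendsto_0:
  fixes c :: real
  assumes "c > 0"
  shows "(\<lambda>n. measure_pmf.prob (gnp n (c / real n))
    {G. real (card (isolated_vertices G)) < exp (- c) / 4 * real n}) \<longlonglongrightarrow> 0"
proof (rule tendsto_sandwich[of "\<lambda>_. 0"])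
  have "(\<lambda>n. (1 + (- c) / real n) ^ n) \<longlonglongrightarrow> exp (- c)"
    by (rule tendsto_exp_limit_sequentially)
  then have "\<forall>\<^sub>F n in sequentially. exp (- c) / 2 < (1 + (- c) / real n) ^ n"
    by (rule order_tendstoD) auto
  moreover have "\<forall>\<^sub>F n in sequentially. n > nat \<lceil>c\<rceil> + 2"
    by (rule eventually_gt_at_top)
  ultimately show "\<forall>\<^sub>F n in sequentially. measure_pmf.prob (gnp n (c / real n))
      {G. real (card (isolated_vertices G)) < exp (- c) / 4 * real n}
      \<le> (1 + c) / (exp (- c) / 4)\<^sup>2 / real n"
  proof eventually_elim
    case (elim n)
    have n: "c < real n" "n \<ge> 2"
      using elim(2) by linarith+
    define p where "p = c / real n"
    define t where "t = exp (- c) / 4 * real n"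
    have p: "0 < p" "p < 1"
      using n assms by (auto simp: p_def)
    have "2 * t = real n * (exp (- c) / 2)"
      by (simp add: t_def)
    also have "\<dots> \<le> real n * (1 - p) ^ n"
      using elim(1) by (intro mult_left_mono) (auto simp: p_def)
    also have "\<dots> \<le> real n * (1 - p) ^ (n - 1)"
      using p by (intro mult_left_mono power_decreasing) auto
    finally have "measure_pmf.prob (gnp n p) {G. real (card (isolated_vertices G)) < t}
        \<le> (real n + (real n)\<^sup>2 * p) / t\<^sup>2"
      using n by (intro prob_few_isolated_vertices_le p) (auto simp: t_def)
    also have "\<dots> = (1 + c) / (exp (- c) / 4)\<^sup>2 / real n"
      using n by (simp add: p_def t_def power2_eq_square field_simps)
    finally show ?case
      by (simp add: p_def t_def)
  qed
  show "(\<lambda>n. (1 + c) / (exp (- c) / 4)\<^sup>2 / real n) \<longlonglongrightarrow> 0"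
    by (rule lim_const_over_n)
qed auto

section \<open>Brooms and giant components\<close>

definition neighbours :: "ugraph \<Rightarrow> nat \<Rightarrow> nat set" where
  "neighbours G v = {u. adjacent G v u}"

definition component_verts :: "ugraph \<Rightarrow> nat \<Rightarrow> nat set" where
  "component_verts G u = {v \<in> verts G. (adjacent G)\<^sup>*\<^sup>* u v}"

definition graph_on :: "nat \<Rightarrow> ugraph \<Rightarrow> bool" where
  "graph_on n G \<longleftrightarrow> verts G = {..<n} \<and> edges G \<subseteq> vertex_pairs n"

lemma adjacent_commute: "adjacent G u v \<longleftrightarrow> adjacent G v u"
  by (simp add: adjacent_def insert_commute)

lemma reachable_sym: "(adjacent G)\<^sup>*\<^sup>* u v \<Longrightarrow> (adjacent G)\<^sup>*\<^sup>* v u"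
  by (metis adjacent_commute symp_def symp_rtranclp)

lemma graph_on_adjacent:
  assumes "graph_on n G" "adjacent G u v"
  shows "u < n" "v < n" "u \<noteq> v"
  using assms by (auto simp: graph_on_def adjacent_def vertex_pairs_def)

lemma finite_neighbours: "graph_on n G \<Longrightarrow> finite (neighbours G v)"
  by (rule finite_subset[of _ "{..<n}"]) (auto simp: neighbours_def dest: graph_on_adjacent)

lemma neighbours_isolated: "graph_on n G \<Longrightarrow> v \<in> isolated_vertices G \<Longrightarrow> neighbours G v = {}"
  by (auto simp: isolated_vertices_def neighbours_def adjacent_def)

lemma finite_component_verts: "graph_on n G \<Longrightarrow> finite (component_verts G u)"
  by (simp add: component_verts_def graph_on_def)

lemma component_verts_closed:
  assumes "graph_on n G" "v \<in> component_verts G u"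
  shows "neighbours G v \<subseteq> component_verts G u"
  using assms graph_on_adjacent[OF assms(1), of v]
  by (auto simp: component_verts_def neighbours_def graph_on_def intro: rtranclp.rtrancl_into_rtrancl)

lemma component_verts_eq:
  assumes "v \<in> component_verts G u"
  shows "component_verts G v = component_verts G u"
  using assms reachable_sym[of G u v] by (auto simp: component_verts_def intro: rtranclp_trans)

lemma is_giant_component_cases:
  assumes "is_giant_component G H"
  obtains u where "u \<in> verts G" "H = induced_subgraph G (component_verts G u)"
    "\<And>w. w \<in> verts G \<Longrightarrow> card (component_verts G w) \<le> card (component_verts G u)"
proof -
  obtain u where u: "u \<in> verts G" "H = induced_subgraph G (component_verts G u)"
    using assms by (auto simp: is_giant_component_def graph_components_def component_verts_def)
  moreover have "card (component_verts G w) \<le> card (component_verts G u)" if "w \<in> verts G" for w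
    using assms that u
    by (auto simp: is_giant_component_def graph_components_def component_verts_def induced_subgraph_def)
  ultimately show ?thesis
    using that by blast
qed

lemma verts_induced_subgraph [simp]: "verts (induced_subgraph G U) = U"
  by (simp add: induced_subgraph_def)

lemma adjacent_induced_subgraph:
  "adjacent (induced_subgraph G U) u v \<longleftrightarrow> adjacent G u v \<and> u \<in> U \<and> v \<in> U"
  by (auto simp: induced_subgraph_def adjacent_def)

text \<open>All vertices of a path from \<open>u\<close> lie in the component, so the path survives
  in the induced subgraph.\<close>

lemma component_connected:
  assumes G: "graph_on n G" and u: "u \<in> verts G"
    and v: "v \<in> component_verts G u" and w: "w \<in> component_verts G u"
  shows "(adjacent (induced_subgraph G (component_verts G u)))\<^sup>*\<^sup>* v w"
proof -
  let ?H = "induced_subgraph G (component_verts G u)"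
  have from_u: "(adjacent ?H)\<^sup>*\<^sup>* u z" if "(adjacent G)\<^sup>*\<^sup>* u z" for z
    using that
  proof (induction rule: rtranclp_induct)
    case (step y z)
    have "(adjacent G)\<^sup>*\<^sup>* u z"
      using step.hyps by (rule rtranclp.rtrancl_into_rtrancl)
    then have "adjacent ?H y z"
      using step.hyps graph_on_adjacent[OF G step.hyps(2)] G
      by (simp add: adjacent_induced_subgraph component_verts_def graph_on_def)
    with step.IH show ?case
      by (rule rtranclp.rtrancl_into_rtrancl)
  qed simp
  have "(adjacent ?H)\<^sup>*\<^sup>* u v" "(adjacent ?H)\<^sup>*\<^sup>* u w"
    using from_u v w by (auto simp: component_verts_def)
  then show ?thesis
    using reachable_sym rtranclp_trans by metis
qed

lemma vertex_degree_component:
  assumes "graph_on n G" "v \<in> component_verts G u"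
  shows "vertex_degree (induced_subgraph G (component_verts G u)) v = card (neighbours G v)"
  using component_verts_closed[OF assms] assms(2) unfolding vertex_degree_def
  by (intro arg_cong[of _ _ card]) (auto simp: adjacent_induced_subgraph neighbours_def)

lemma neighbours_nonempty:
  assumes G: "graph_on n G" and v: "v \<in> component_verts G u" and "card (component_verts G u) \<ge> 2"
  shows "neighbours G v \<noteq> {}"
proof -
  have "component_verts G u \<noteq> {v}"
    using assms(3) by auto
  then obtain w where w: "w \<in> component_verts G u" "w \<noteq> v"
    using v by blast
  then have "(adjacent G)\<^sup>*\<^sup>* v w"
    using component_verts_eq[OF v] by (auto simp: component_verts_def)
  then show ?thesis
    using w(2) by (auto simp: neighbours_def elim: converse_rtranclpE)
qed

text \<open>At most one neighbour is not a leaf. The degree is bounded rather than fixed because the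
  edge leading to this neighbour may disappear when another star is deleted.\<close>

definition broom_centre :: "nat \<Rightarrow> ugraph \<Rightarrow> nat \<Rightarrow> bool" where
  "broom_centre m G x \<longleftrightarrow> card (neighbours G x) \<le> m + 1 \<and>
     m \<le> card {y \<in> neighbours G x. neighbours G y = {x}}"

text \<open>The cut separates \<open>x\<close> and its leaves, at most \<open>m + 2\<close>
  vertices. The threshold \<open>3 * m + 2\<close> leaves \<open>2 * m\<close> vertices outside,
  each of degree at least 1, so both sides have volume at least \<open>2 * m\<close> and the
  conductance bound gives \<open>1 / (2 * m)\<close> twice.\<close>

lemma lambda1_le_broom:
  assumes G: "graph_on n G" and u: "u \<in> verts G"
    and x: "x \<in> component_verts G u" "broom_centre m G x"
    and m: "m \<ge> 1" and big: "card (component_verts G u) \<ge> 3 * m + 2"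
  shows "lambda1 (induced_subgraph G (component_verts G u)) \<le> 1 / real m"
proof -
  define U where "U = component_verts G u"
  define H where "H = induced_subgraph G U"
  define Y where "Y = {y \<in> neighbours G x. neighbours G y = {x}}"
  define S where "S = insert x Y"
  have finU: "finite U"
    using finite_component_verts[OF G] by (simp add: U_def)
  have xU: "x \<in> U"
    using x by (simp add: U_def)
  have H: "verts H = U"
    by (simp add: H_def)
  have deg: "vertex_degree H v = card (neighbours G v)" if "v \<in> U" for v
    using vertex_degree_component[OF G] that by (simp add: H_def U_def)
  have deg1: "vertex_degree H v \<ge> 1" if "v \<in> U" for v
    using neighbours_nonempty[OF G, of v u] finite_neighbours[OF G, of v] that big
    by (simp add: deg U_def Suc_le_eq card_gt_0_iff)
  have YN: "Y \<subseteq> neighbours G x" and NU: "neighbours G x \<subseteq> U"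
    using component_verts_closed[OF G x(1)] by (auto simp: Y_def U_def)
  have SU: "S \<subseteq> U"
    using YN NU xU by (auto simp: S_def)
  have finY: "finite Y"
    using YN finite_neighbours[OF G] by (rule finite_subset)
  have xY: "x \<notin> Y"
    using YN graph_on_adjacent(3)[OF G, of x x] by (auto simp: neighbours_def)
  have cY: "m \<le> card Y" "card (neighbours G x) \<le> m + 1"
    using x(2) by (simp_all add: broom_centre_def Y_def)
  have cYN: "card Y \<le> card (neighbours G x)"
    using YN finite_neighbours[OF G] by (simp add: card_mono)
  have "lambda1 H \<le> 1 * (1 / real (2 * m) + 1 / real (2 * m))"
  proof (rule lambda1_le_conductance[of H S])
    show "\<Union>(edges H) \<subseteq> verts H"
      by (auto simp: H_def induced_subgraph_def)
    show "(adjacent H)\<^sup>*\<^sup>* v w" if "v \<in> verts H" "w \<in> verts H" for v w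
      using component_connected[OF G u] that by (simp add: H H_def U_def)
    have "real (2 * m) \<le> real (card (neighbours G x) + card Y)"
      using cY cYN by simp
    also have "\<dots> \<le> (\<Sum>v\<in>S. real (vertex_degree H v))"
    proof -
      have "real (card Y) \<le> (\<Sum>v\<in>Y. real (vertex_degree H v))"
        using sum_mono[of Y "\<lambda>_. 1" "\<lambda>v. real (vertex_degree H v)"] deg1 SU
        by (auto simp: S_def)
      then show ?thesis
        using finY xY xU by (simp add: S_def deg)
    qed
    finally show "real (2 * m) \<le> (\<Sum>v\<in>S. real (vertex_degree H v))" .
    have "card S \<le> m + 2"
      using cY cYN finY xY by (simp add: S_def)
    then have "2 * m \<le> card (U - S)"
      using big finU SU by (simp add: card_Diff_subset finite_subset U_def)
    also have "real (card (U - S)) \<le> (\<Sum>v\<in>U - S. real (vertex_degree H v))"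
      using sum_mono[of "U - S" "\<lambda>_. 1" "\<lambda>v. real (vertex_degree H v)"] deg1 by simp
    finally show "real (2 * m) \<le> (\<Sum>v\<in>verts H - S. real (vertex_degree H v))"
      by (simp add: H)
    have leaf: "(\<Sum>v\<in>U - S. adj_weight H y v) = 0" if "y \<in> Y" for y
    proof (intro sum.neutral ballI)
      fix v assume "v \<in> U - S"
      then have "v \<notin> neighbours G y"
        using that by (auto simp: Y_def S_def)
      then show "adj_weight H y v = 0"
        by (simp add: adj_weight_def H_def adjacent_induced_subgraph neighbours_def)
    qed
    have "(\<Sum>v\<in>U - S. adj_weight H x v) = real (card {v \<in> U - S. adjacent H x v})"
      using finU by (simp add: adj_weight_def sum.If_cases Int_def)
    also have "\<dots> \<le> real (card (neighbours G x - Y))"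
      using finite_neighbours[OF G]
      by (intro of_nat_mono card_mono) (auto simp: neighbours_def S_def H_def adjacent_induced_subgraph)
    also have "\<dots> \<le> 1"
      using finY YN cY by (simp add: card_Diff_subset)
    finally show "(\<Sum>v\<in>S. \<Sum>w\<in>verts H - S. adj_weight H v w) \<le> 1"
      using finY xY leaf by (simp add: S_def[symmetric] H) (simp add: S_def leaf[unfolded S_def])
  qed (use H finU SU deg1 m in \<open>auto simp: Suc_le_eq\<close>)
  also have "\<dots> = 1 / real m"
    using m by simp
  finally show ?thesis
    by (simp add: H_def U_def)
qed

section \<open>Attaching a star with an isolated centre\<close>

definition star :: "nat \<Rightarrow> nat set \<Rightarrow> nat set set" where
  "star x Y = (\<lambda>y. {x, y}) ` Y"

definition add_edges :: "ugraph \<Rightarrow> nat set set \<Rightarrow> ugraph" where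
  "add_edges G F = (verts G, edges G \<union> F)"

lemma card_star: "x \<notin> Y \<Longrightarrow> card (star x Y) = card Y"
  unfolding star_def by (intro card_image) (auto simp: inj_on_def doubleton_eq_iff)

lemma star_subset_vertex_pairs: "x < n \<Longrightarrow> Y \<subseteq> {..<n} - {x} \<Longrightarrow> star x Y \<subseteq> vertex_pairs n"
  by (auto simp: star_def vertex_pairs_def card_insert_if)

lemma star_disjoint_edges: "x \<in> isolated_vertices G \<Longrightarrow> star x Y \<inter> edges G = {}"
  by (auto simp: star_def isolated_vertices_def)

lemma adjacent_add_star:
  "adjacent (add_edges G (star x Y)) u v \<longleftrightarrow>
     adjacent G u v \<or> (u = x \<and> v \<in> Y) \<or> (v = x \<and> u \<in> Y)"
  by (auto simp: add_edges_def star_def adjacent_def doubleton_eq_iff)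

lemma neighbours_add_star_centre:
  assumes "graph_on n G" "x \<in> isolated_vertices G" "x \<notin> Y"
  shows "neighbours (add_edges G (star x Y)) x = Y"
  using neighbours_isolated[OF assms(1,2)] assms(3) by (auto simp: neighbours_def adjacent_add_star)

lemma neighbours_add_star:
  "v \<noteq> x \<Longrightarrow> neighbours (add_edges G (star x Y)) v = neighbours G v \<union> (if v \<in> Y then {x} else {})"
  by (auto simp: neighbours_def adjacent_add_star)

text \<open>As \<open>x\<close> had no edges before, deleting all edges at \<open>x\<close> undoes
  the addition, whatever the leaf set. Only the centre has to be recognised.\<close>

lemma add_star_inject:
  assumes "add_edges G (star x Y) = add_edges G' (star x Y')"
    and "x \<in> isolated_vertices G" "x \<in> isolated_vertices G'"
  shows "G = G'"
proof -
  have *: "edges K = {e \<in> edges K \<union> star x Z. x \<notin> e}" if "x \<in> isolated_vertices K" for K Z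
    using that by (auto simp: isolated_vertices_def star_def)
  have "verts G = verts G'" "edges G \<union> star x Y = edges G' \<union> star x Y'"
    using assms(1) by (auto simp: add_edges_def)
  then show ?thesis
    using *[OF assms(2), of Y] *[OF assms(3), of Y'] by (simp add: prod_eq_iff)
qed

text \<open>The component of \<open>h\<close> absorbs the star and gains at least \<open>x\<close>.
  Any other component of the new graph lies inside an old one, so it has at most as many vertices as
  \<open>H\<close> and is strictly smaller. The giant component is thus forced even if
  \<open>G\<close> had ties.\<close>

lemma verts_giant_add_star:
  assumes G: "graph_on n G"
    and H: "is_giant_component G H" and H': "is_giant_component (add_edges G (star x (insert h Y))) H'"
    and h: "h \<in> verts H" and x: "x \<in> isolated_vertices G" "x \<notin> verts H" and Y: "Y \<subseteq> isolated_vertices G"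
  shows "verts H' = verts H \<union> insert x Y"
proof -
  define G' where "G' = add_edges G (star x (insert h Y))"
  obtain u where u: "u \<in> verts G" "H = induced_subgraph G (component_verts G u)"
    "\<And>w. w \<in> verts G \<Longrightarrow> card (component_verts G w) \<le> card (component_verts G u)"
    using is_giant_component_cases[OF H] by metis
  define U where "U = component_verts G u"
  have U: "verts H = U"
    by (simp add: u U_def)
  define C where "C = U \<union> insert x Y"
  have V: "verts G' = verts G" "x \<in> verts G" "finite (verts G)"
    using x G by (auto simp: G'_def add_edges_def isolated_vertices_def graph_on_def)
  have adj: "adjacent G' a b \<longleftrightarrow> adjacent G a b \<or> (a = x \<and> b \<in> insert h Y) \<or> (b = x \<and> a \<in> insert h Y)" for a b
    unfolding G'_def by (rule adjacent_add_star)
  have hU: "h \<in> U" "h \<in> verts G"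
    using h U by (auto simp: U_def component_verts_def)
  have CV: "C \<subseteq> verts G"
    using Y V by (auto simp: C_def U_def component_verts_def isolated_vertices_def)
  have fromx: "(adjacent G')\<^sup>*\<^sup>* x w" if "w \<in> C" for w
  proof (cases "w \<in> U")
    case True
    then have "(adjacent G)\<^sup>*\<^sup>* h w"
      using component_verts_eq[of h G u] hU by (auto simp: U_def component_verts_def)
    then have "(adjacent G')\<^sup>*\<^sup>* h w"
      by (rule rtranclp_mono[THEN predicate2D, rotated]) (auto simp: adj)
    moreover have "adjacent G' x h"
      by (simp add: adj)
    ultimately show ?thesis
      by (rule converse_rtranclp_into_rtranclp[rotated])
  next
    case False
    then have "w = x \<or> adjacent G' x w"
      using that by (auto simp: C_def adj)
    then show ?thesis
      by auto
  qed
  have Cx: "C \<subseteq> component_verts G' x"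
    using fromx CV V by (auto simp: component_verts_def)
  \<comment> \<open>A path starting outside \<open>C\<close> never enters it: both ends of each new
    edge are in \<open>C\<close>, and an old edge cannot enter because \<open>U\<close> is closed
    under adjacency and the rest of \<open>C\<close> was isolated.\<close>
  have outside: "w \<notin> C \<and> (adjacent G)\<^sup>*\<^sup>* v w" if "(adjacent G')\<^sup>*\<^sup>* v w" "v \<notin> C" for v w
    using that
  proof (induction rule: rtranclp_induct)
    case (step y z)
    then have y: "y \<notin> C" "(adjacent G)\<^sup>*\<^sup>* v y"
      by auto
    have yz: "adjacent G y z"
      using step.hyps(2) y(1) hU by (auto simp: adj C_def)
    have "z \<notin> U"
    proof
      assume "z \<in> U"
      then have "y \<in> U"
        using component_verts_closed[OF G, of z u] yz by (auto simp: U_def neighbours_def adjacent_commute)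
      then show False
        using y(1) by (simp add: C_def)
    qed
    moreover have "z \<notin> isolated_vertices G"
      using yz by (auto simp: isolated_vertices_def adjacent_def)
    ultimately have "z \<notin> C"
      using x(1) Y by (auto simp: C_def)
    then show ?case
      using y(2) yz by (auto intro: rtranclp.rtrancl_into_rtrancl)
  qed simp
  have "component_verts G' x \<subseteq> C"
    using outside[OF reachable_sym[of G' x]] by (auto simp: component_verts_def C_def)
  then have Cx: "component_verts G' x = C"
    using Cx by blast
  obtain u' where u': "u' \<in> verts G'" "H' = induced_subgraph G' (component_verts G' u')"
    "\<And>w. w \<in> verts G' \<Longrightarrow> card (component_verts G' w) \<le> card (component_verts G' u')"
    using is_giant_component_cases[OF H'[folded G'_def]] by metis
  have "u' \<in> C"
  proof (rule ccontr)
    assume "u' \<notin> C"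
    have finC: "finite C"
      using CV V(3) by (rule finite_subset)
    have "component_verts G' u' \<subseteq> component_verts G u'"
      using outside[OF _ \<open>u' \<notin> C\<close>] V by (auto simp: component_verts_def)
    then have "card (component_verts G' u') \<le> card (component_verts G u')"
      using finite_component_verts[OF G] by (intro card_mono)
    also have "\<dots> \<le> card U"
      using u(3) u'(1) V by (simp add: U_def)
    also have "\<dots> < card C"
      using finC x(2) U by (intro psubset_card_mono) (auto simp: C_def)
    also have "\<dots> \<le> card (component_verts G' u')"
      using u'(3)[of x] V Cx by simp
    finally show False
      by simp
  qed
  then have "component_verts G' u' = C"
    using component_verts_eq[of u' G' x] Cx by simp
  then show ?thesis
    by (simp add: u' C_def U)
qed

section \<open>The switchings\<close>

text \<open>For \<open>0 < p < 1\<close> the support consists of all graphs on \<open>n\<close>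
  vertices, so a property assumed on the support also holds for the graphs produced by
  switching.\<close>

lemma mem_set_pmf_gnp_iff:
  "0 < p \<Longrightarrow> p < 1 \<Longrightarrow> G \<in> set_pmf (gnp n p) \<longleftrightarrow> graph_on n G"
  by (cases G) (auto simp: set_pmf_gnp graph_on_def)

lemma finite_graph_on: "finite {G. graph_on n G}"
  by (rule finite_subset[of _ "{{..<n}} \<times> Pow (vertex_pairs n)"]) (auto simp: graph_on_def)

lemma graph_on_add_star:
  assumes "graph_on n G" "x \<in> verts G" "Y \<subseteq> verts G - {x}"
  shows "graph_on n (add_edges G (star x Y))"
  using assms star_subset_vertex_pairs[of x n Y] by (auto simp: graph_on_def add_edges_def)

lemma pmf_gnp_add_star:
  assumes p: "0 < p" "p < 1" and G: "graph_on n G"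
    and x: "x \<in> isolated_vertices G" and Y: "Y \<subseteq> verts G - {x}" "card Y = m"
  shows "p ^ m * pmf (gnp n p) G \<le> pmf (gnp n p) (add_edges G (star x Y))"
proof -
  have "verts G = {..<n}" "x < n"
    using G x by (auto simp: graph_on_def isolated_vertices_def)
  then have "star x Y \<subseteq> vertex_pairs n - edges G"
    using star_subset_vertex_pairs[of x n Y] star_disjoint_edges[OF x, of Y] Y by auto
  moreover have "card (star x Y) = m"
    using Y by (subst card_star) auto
  moreover have "edges G \<subseteq> vertex_pairs n" "G = ({..<n}, edges G)" "verts G = {..<n}"
    using G by (auto simp: graph_on_def prod_eq_iff)
  ultimately show ?thesis
    using pmf_gnp_add_edges[OF p, of "edges G" n "star x Y" m] by (simp add: add_edges_def)
qed

section \<open>Counting stars and bounding the exceptional events\<close>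

definition star_choices :: "nat \<Rightarrow> nat set \<Rightarrow> (nat \<times> nat set) set" where
  "star_choices m I = (SIGMA x:I. {Y. Y \<subseteq> I - {x} \<and> card Y = m})"

lemma finite_star_choices: "finite I \<Longrightarrow> finite (star_choices m I)"
  unfolding star_choices_def by (intro finite_SigmaI) auto

text \<open>The centre contributes \<open>card I\<close> choices and the leaves
  \<open>N choose m \<ge> (N / m) ^ m\<close>. The 2 in the base pays for the exclusion of the
  centre: \<open>N = card I - 1 \<ge> t / 2\<close>.\<close>

lemma card_star_choices_ge:
  assumes fin: "finite I" and t: "t \<le> real (card I)" "t \<ge> 2 * real m + 2" and m: "m \<ge> 1"
  shows "t * (t / (2 * real m)) ^ m \<le> real (card (star_choices m I))"
proof -
  define N where "N = card I - 1"
  have N: "t / 2 \<le> real N" "m \<le> N"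
    using t by (auto simp: N_def of_nat_diff)
  have "card {Y. Y \<subseteq> I - {x} \<and> card Y = m} = N choose m" if "x \<in> I" for x
    using n_subsets[of "I - {x}" m] fin that by (simp add: N_def)
  then have "card (star_choices m I) = card I * (N choose m)"
    unfolding star_choices_def using fin by (subst card_SigmaI) auto
  moreover have "(t / (2 * real m)) ^ m \<le> (real N / real m) ^ m"
  proof (rule power_mono)
    show "t / (2 * real m) \<le> real N / real m"
      using divide_right_mono[OF N(1), of "real m"] by simp
  qed (use t in simp)
  moreover have "(real N / real m) ^ m \<le> real (N choose m)"
    using binomial_ge_n_over_k_pow_k[OF N(2), where 'a = real] by simp
  ultimately show ?thesis
    using t by (auto intro!: mult_mono)
qed

text \<open>After a star with \<open>k\<close> leaves is added, its centre is the only vertex of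
  degree at least \<open>k\<close>: the leaves have degree 1, where \<open>k \<ge> 2\<close>
  matters, and all other degrees are unchanged. For \<open>t\<close> linear in n and
  \<open>p = c / n\<close> the switching factor grows linearly.\<close>

lemma prob_small_degrees_le:
  assumes p: "0 < p" "p < 1" and k: "k \<ge> 2" and t: "t \<ge> 2 * real k + 2"
  shows "measure_pmf.prob (gnp n p) {G. graph_on n G \<and> t \<le> real (card (isolated_vertices G)) \<and>
      (\<forall>v\<in>verts G. card (neighbours G v) < k)} * (t * (t / (2 * real k)) ^ k * p ^ k) \<le> 1"
    (is "measure_pmf.prob _ ?A * _ \<le> 1")
proof (rule switching_bound[where R = "\<lambda>G. star_choices k (isolated_vertices G)"
      and f = "\<lambda>G (x, Y). add_edges G (star x Y)"])
  show "finite ?A"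
    by (rule finite_subset[OF _ finite_graph_on[of n]]) auto
  have iso: "isolated_vertices G \<subseteq> verts G" "finite (isolated_vertices G)" if "G \<in> ?A" for G
    using that by (auto simp: isolated_vertices_def graph_on_def)
  show "finite (star_choices k (isolated_vertices G))" if "G \<in> ?A" for G
    using iso[OF that] by (intro finite_star_choices)
  show "t * (t / (2 * real k)) ^ k \<le> real (card (star_choices k (isolated_vertices G)))"
    if "G \<in> ?A" for G
    using that k t iso[OF that] by (intro card_star_choices_ge) auto
  show "p ^ k * pmf (gnp n p) G \<le> pmf (gnp n p) (case l of (x, Y) \<Rightarrow> add_edges G (star x Y))"
    if "G \<in> ?A" "l \<in> star_choices k (isolated_vertices G)" for G l
    using that iso[OF that(1)] by (cases l) (auto simp: star_choices_def intro!: pmf_gnp_add_star[OF p])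
  have large: "v = x \<and> neighbours (add_edges G (star x Y)) v = Y"
    if "G \<in> ?A" "(x, Y) \<in> star_choices k (isolated_vertices G)" "v \<in> verts G"
      "k \<le> card (neighbours (add_edges G (star x Y)) v)" for G x Y v
  proof -
    have G: "graph_on n G" "card (neighbours G v) < k"
      and xY: "x \<in> isolated_vertices G" "Y \<subseteq> isolated_vertices G" "x \<notin> Y"
      using that by (auto simp: star_choices_def)
    have "v = x"
    proof (rule ccontr)
      assume "v \<noteq> x"
      then show False
        using that(4) G k xY neighbours_isolated[OF G(1), of v]
        by (cases "v \<in> Y") (auto simp: neighbours_add_star)
    qed
    then show ?thesis
      using neighbours_add_star_centre[OF G(1) xY(1,3)] by simp
  qed
  show "inj_on (\<lambda>(G, l). case l of (x, Y) \<Rightarrow> add_edges G (star x Y))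
      (SIGMA G:?A. star_choices k (isolated_vertices G))"
  proof (rule inj_onI)
    fix a b
    assume ab: "a \<in> (SIGMA G:?A. star_choices k (isolated_vertices G))"
        "b \<in> (SIGMA G:?A. star_choices k (isolated_vertices G))"
      and eq: "(\<lambda>(G, l). case l of (x, Y) \<Rightarrow> add_edges G (star x Y)) a =
        (\<lambda>(G, l). case l of (x, Y) \<Rightarrow> add_edges G (star x Y)) b"
    obtain G1 x1 Y1 where a: "a = (G1, x1, Y1)"
      by (cases a)
    obtain G2 x2 Y2 where b: "b = (G2, x2, Y2)"
      by (cases b)
    have 1: "G1 \<in> ?A" "(x1, Y1) \<in> star_choices k (isolated_vertices G1)"
      and 2: "G2 \<in> ?A" "(x2, Y2) \<in> star_choices k (isolated_vertices G2)"
      and eq: "add_edges G1 (star x1 Y1) = add_edges G2 (star x2 Y2)"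
      using ab eq by (simp_all add: a b)
    have x1: "x1 \<in> isolated_vertices G1" "x1 \<notin> Y1" "card Y1 = k" "x1 \<in> verts G1"
      and x2: "x2 \<in> isolated_vertices G2"
      using 1 2 by (auto simp: star_choices_def isolated_vertices_def)
    have "neighbours (add_edges G1 (star x1 Y1)) x1 = Y1"
      using 1 x1 by (intro neighbours_add_star_centre[of n]) auto
    moreover have "x1 \<in> verts G2"
      using 1 2 x1(4) by (simp add: graph_on_def)
    ultimately have "x1 = x2" "Y1 = Y2"
      using large[OF 2, of x1] x1(3) by (simp_all add: eq)
    moreover have "G1 = G2"
      using add_star_inject[of G1 x2 Y1 G2 Y2] eq x1(1) x2 \<open>x1 = x2\<close> by simp
    ultimately show "a = b"
      by (simp add: a b)
  qed
qed (use p in simp)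

lemma neighbours_add_star_leaf:
  assumes "graph_on n G" "y \<in> isolated_vertices G" "y \<noteq> x" "y \<in> Y"
  shows "neighbours (add_edges G (star x Y)) y = {x}"
  using assms neighbours_isolated[OF assms(1,2)] by (simp add: neighbours_add_star)

text \<open>If one graph arises from two broomless graphs by attaching stars, the stars have the same
  centre: removing one of them would leave a broom at the centre of the other.\<close>

lemma broom_centre_of_add_star:
  assumes G1: "graph_on n G1" and G2: "graph_on n G2"
    and 1: "x1 \<in> isolated_vertices G1" "Y1 \<subseteq> isolated_vertices G1" "x1 \<notin> insert h1 Y1" "card Y1 = m"
    and 2: "x2 \<noteq> x1" "x2 \<notin> Y1"
    and eq: "add_edges G1 (star x1 (insert h1 Y1)) = add_edges G2 (star x2 Z)"
  shows "broom_centre m G2 x1"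
proof -
  define G' where "G' = add_edges G1 (star x1 (insert h1 Y1))"
  have sub: "neighbours G2 v \<subseteq> neighbours G' v" for v
    by (auto simp: G'_def eq neighbours_def adjacent_add_star)
  have N: "neighbours G' x1 = insert h1 Y1"
    unfolding G'_def by (rule neighbours_add_star_centre[OF G1 1(1,3)])
  have finY: "finite Y1"
    using 1(2) G1 by (auto simp: isolated_vertices_def graph_on_def intro: finite_subset)
  have "card (neighbours G2 x1) \<le> card (insert h1 Y1)"
    using sub[of x1] finY by (intro card_mono) (auto simp: N)
  also have "\<dots> \<le> m + 1"
    using 1(4) finY by (simp add: card_insert_if)
  finally have "card (neighbours G2 x1) \<le> m + 1" .
  moreover have "Y1 \<subseteq> {y \<in> neighbours G2 x1. neighbours G2 y = {x1}}"
  proof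
    fix y assume y: "y \<in> Y1"
    have "neighbours G' y = {x1}"
      unfolding G'_def using y 1 by (intro neighbours_add_star_leaf[OF G1]) auto
    moreover have "adjacent G' x1 y"
      using y N by (auto simp: neighbours_def)
    \<comment> \<open>Neither end of this edge is \<open>x2\<close>, so it does not belong to the
      second star.\<close>
    then have "adjacent G2 x1 y"
      using 2 y by (auto simp: G'_def eq adjacent_add_star)
    ultimately show "y \<in> {y \<in> neighbours G2 x1. neighbours G2 y = {x1}}"
      using sub[of y] by (auto simp: neighbours_def adjacent_commute)
  qed
  then have "m \<le> card {y \<in> neighbours G2 x1. neighbours G2 y = {x1}}"
    using card_mono[of "{y \<in> neighbours G2 x1. neighbours G2 y = {x1}}" Y1]
      finite_neighbours[OF G2] 1(4) by simp
  ultimately show ?thesis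
    by (simp add: broom_centre_def)
qed

text \<open>Here \<open>H\<close> is an arbitrary selection of giant components. Compared with the
  weight \<open>p ^ (m + 1)\<close>, the \<open>m + 1\<close> isolated vertices only balance the
  powers of n; the gain \<open>K\<close> comes from the choice of the attachment vertex
  \<open>h\<close>.\<close>

lemma prob_no_broom_le:
  fixes H :: "ugraph \<Rightarrow> ugraph"
  assumes p: "0 < p" "p < 1" and m: "m \<ge> 1" and K: "K \<ge> 2" and t: "t \<ge> 2 * real m + 2"
    and giant: "\<And>G. graph_on n G \<Longrightarrow> is_giant_component G (H G)"
  shows "measure_pmf.prob (gnp n p) {G. graph_on n G \<and> t \<le> real (card (isolated_vertices G)) \<and>
      K \<le> card (verts (H G)) \<and> (\<forall>x\<in>verts (H G). \<not> broom_centre m G x)} *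
      (real K * (t * (t / (2 * real m)) ^ m) * p ^ (m + 1)) \<le> 1"
    (is "measure_pmf.prob _ ?A * _ \<le> 1")
proof (rule switching_bound[where
      R = "\<lambda>G. verts (H G) \<times> star_choices m (isolated_vertices G)"
      and f = "\<lambda>G (h, x, Y). add_edges G (star x (insert h Y))"])
  show "finite ?A"
    by (rule finite_subset[OF _ finite_graph_on[of n]]) auto
  have iso: "isolated_vertices G \<subseteq> verts G" "finite (isolated_vertices G)" if "G \<in> ?A" for G
    using that by (auto simp: isolated_vertices_def graph_on_def)
  \<comment> \<open>Having at least two vertices, the giant component contains no isolated one. This
    separates \<open>h\<close> from \<open>x\<close> and \<open>Y\<close>.\<close>
  have HG: "finite (verts (H G))" "verts (H G) \<subseteq> verts G" "verts (H G) \<inter> isolated_vertices G = {}"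
    if "G \<in> ?A" for G
  proof -
    have G: "graph_on n G" "card (verts (H G)) \<ge> 2"
      using that K by auto
    obtain u where u: "H G = induced_subgraph G (component_verts G u)"
      using is_giant_component_cases[OF giant[OF G(1)]] by metis
    show "finite (verts (H G))" "verts (H G) \<subseteq> verts G"
      using finite_component_verts[OF G(1)] by (auto simp: u component_verts_def)
    show "verts (H G) \<inter> isolated_vertices G = {}"
      using neighbours_nonempty[OF G(1), of _ u] neighbours_isolated[OF G(1)] G(2) by (auto simp: u)
  qed
  show "finite (verts (H G) \<times> star_choices m (isolated_vertices G))" if "G \<in> ?A" for G
    using HG(1)[OF that] iso[OF that] by (intro finite_cartesian_product finite_star_choices)
  show "real K * (t * (t / (2 * real m)) ^ m)
      \<le> real (card (verts (H G) \<times> star_choices m (isolated_vertices G)))" if "G \<in> ?A" for G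
  proof -
    have "t * (t / (2 * real m)) ^ m \<le> real (card (star_choices m (isolated_vertices G)))"
      using that m t iso[OF that] by (intro card_star_choices_ge) auto
    moreover have "real K \<le> real (card (verts (H G)))"
      using that by simp
    ultimately show ?thesis
      using t by (simp add: card_cartesian_product mult_mono)
  qed
  have choice: "h \<in> verts (H G)" "x \<in> isolated_vertices G" "Y \<subseteq> isolated_vertices G" "card Y = m"
      "x \<notin> insert h Y" "h \<notin> Y" "insert h Y \<subseteq> verts G - {x}" "x \<notin> verts (H G)" "finite Y"
    if "G \<in> ?A" "(h, x, Y) \<in> verts (H G) \<times> star_choices m (isolated_vertices G)" for G h x Y
    using HG[OF that(1)] iso[OF that(1)] that(2) by (auto simp: star_choices_def intro: finite_subset)
  show "p ^ (m + 1) * pmf (gnp n p) G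
      \<le> pmf (gnp n p) (case l of (h, x, Y) \<Rightarrow> add_edges G (star x (insert h Y)))"
    if G: "G \<in> ?A" and l: "l \<in> verts (H G) \<times> star_choices m (isolated_vertices G)" for G l
  proof -
    obtain h x Y where hxY: "l = (h, x, Y)"
      by (cases l)
    note c = choice[OF G l[unfolded hxY]]
    have "card (insert h Y) = m + 1"
      using c by simp
    then show ?thesis
      using pmf_gnp_add_star[OF p, of n G x "insert h Y" "m + 1"] c G by (simp add: hxY)
  qed
  show "inj_on (\<lambda>(G, l). case l of (h, x, Y) \<Rightarrow> add_edges G (star x (insert h Y)))
      (SIGMA G:?A. verts (H G) \<times> star_choices m (isolated_vertices G))"
  proof (rule inj_onI)
    fix a b
    assume ab: "a \<in> (SIGMA G:?A. verts (H G) \<times> star_choices m (isolated_vertices G))"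
        "b \<in> (SIGMA G:?A. verts (H G) \<times> star_choices m (isolated_vertices G))"
      and eq: "(\<lambda>(G, l). case l of (h, x, Y) \<Rightarrow> add_edges G (star x (insert h Y))) a =
        (\<lambda>(G, l). case l of (h, x, Y) \<Rightarrow> add_edges G (star x (insert h Y))) b"
    obtain G1 h1 x1 Y1 where a: "a = (G1, h1, x1, Y1)"
      by (cases a)
    obtain G2 h2 x2 Y2 where b: "b = (G2, h2, x2, Y2)"
      by (cases b)
    have 1: "G1 \<in> ?A" "(h1, x1, Y1) \<in> verts (H G1) \<times> star_choices m (isolated_vertices G1)"
      and 2: "G2 \<in> ?A" "(h2, x2, Y2) \<in> verts (H G2) \<times> star_choices m (isolated_vertices G2)"
      and eq: "add_edges G1 (star x1 (insert h1 Y1)) = add_edges G2 (star x2 (insert h2 Y2))"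
      using ab eq by (simp_all add: a b)
    note c1 = choice[OF 1] and c2 = choice[OF 2]
    have G1: "graph_on n G1" and G2: "graph_on n G2"
      using 1 2 by auto
    define G' where "G' = add_edges G1 (star x1 (insert h1 Y1))"
    have G'2: "G' = add_edges G2 (star x2 (insert h2 Y2))"
      using eq by (simp add: G'_def)
    have "graph_on n G'"
      unfolding G'_def using c1 iso(1)[OF 1(1)] by (intro graph_on_add_star[OF G1]) auto
    note H' = giant[OF this]
    have V1: "verts (H G') = verts (H G1) \<union> insert x1 Y1"
      using verts_giant_add_star[OF G1 giant[OF G1] H'[unfolded G'_def] c1(1,2,8,3)] by (simp add: G'_def)
    have V2: "verts (H G') = verts (H G2) \<union> insert x2 Y2"
      using verts_giant_add_star[OF G2 giant[OF G2] H'[unfolded G'2] c2(1,2,8,3)] by (simp add: G'2)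
    have N1: "neighbours G' x1 = insert h1 Y1"
      unfolding G'_def by (rule neighbours_add_star_centre[OF G1 c1(2,5)])
    have N2: "neighbours G' x2 = insert h2 Y2"
      unfolding G'2 by (rule neighbours_add_star_centre[OF G2 c2(2,5)])
    have cN: "card (neighbours G' x1) = m + 1" "card (neighbours G' x2) = m + 1"
      using c1 c2 by (simp_all add: N1 N2)
    have leaf1: "card (neighbours G' y) = 1" if "y \<in> Y1" for y
      unfolding G'_def using that c1 by (subst neighbours_add_star_leaf[OF G1]) auto
    have leaf2: "card (neighbours G' y) = 1" if "y \<in> Y2" for y
      unfolding G'2 using that c2 by (subst neighbours_add_star_leaf[OF G2]) auto
    have x: "x1 = x2"
    proof (rule ccontr)
      assume ne: "x1 \<noteq> x2"
      \<comment> \<open>In \<open>G'\<close> a centre has degree \<open>m + 1 \<ge> 2\<close>, a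
        leaf degree 1.\<close>
      have "x2 \<notin> Y1" "x1 \<notin> Y2"
        using leaf1[of x2] leaf2[of x1] cN m by auto
      then have "broom_centre m G2 x1"
        using ne by (intro broom_centre_of_add_star[OF G1 G2 c1(2,3,5,4) _ _ eq]) auto
      \<comment> \<open>Both descriptions of the giant component of \<open>G'\<close> contain
        \<open>x1\<close>; in the second it can only come from \<open>H G2\<close>, where brooms are
        excluded.\<close>
      moreover have "x1 \<in> verts (H G2)"
        using V1 V2 ne \<open>x1 \<notin> Y2\<close> by blast
      ultimately show False
        using 2(1) by blast
    qed
    have G: "G1 = G2"
      using add_star_inject[of G1 x2 "insert h1 Y1" G2 "insert h2 Y2"] eq c1(2) c2(2) x by simp
    have ins: "insert h1 Y1 = insert h2 Y2"
      using N1 N2 x by simp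
    \<comment> \<open>Among the neighbours of the centre, the attachment vertex is the only one in
      the giant component of the original graph, as the leaves were isolated there.\<close>
    have "h1 = h2"
      using ins c1 c2 HG(3)[OF 2(1)] G by blast
    moreover have "Y1 = Y2"
      using ins \<open>h1 = h2\<close> c1(6) c2(6) by (metis insert_ident)
    ultimately show "a = b"
      using G x by (simp add: a b)
  qed
qed (use p in simp)

section \<open>Choice of constants and passage to the limit\<close>

lemma card_neighbours_less_component:
  assumes G: "graph_on n G" and v: "v \<in> verts G"
  shows "card (neighbours G v) < card (component_verts G v)"
proof -
  have "v \<in> component_verts G v"
    using v by (simp add: component_verts_def)
  moreover have "v \<notin> neighbours G v"
    using graph_on_adjacent(3)[OF G, of v v] by (auto simp: neighbours_def)
  ultimately have "neighbours G v \<subset> component_verts G v"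
    using component_verts_closed[OF G, of v v] by blast
  then show ?thesis
    using finite_component_verts[OF G] by (intro psubset_card_mono)
qed

theorem corollary2p3:
  fixes c :: real and H :: "nat \<Rightarrow> ugraph \<Rightarrow> ugraph"
  assumes "c > 1"
    and "\<And>n G. real n \<ge> c \<Longrightarrow> G \<in> set_pmf (gnp n (c / real n)) \<Longrightarrow>
           is_giant_component G (H n G)"
  shows "\<forall>\<epsilon>>0. (\<lambda>n. measure_pmf.prob (gnp n (c / real n)) {G. lambda1 (H n G) < \<epsilon>})
           \<longlonglongrightarrow> 1"
proof (intro allI impI)
  fix \<epsilon> :: real assume \<epsilon>: "\<epsilon> > 0"
  define P where "P n = measure_pmf.prob (gnp n (c / real n))" for n
  define \<alpha> where "\<alpha> = exp (- c) / 4"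
  define m where "m = nat \<lceil>1 / \<epsilon>\<rceil> + 1"
  have m: "m \<ge> 1" "1 / real m < \<epsilon>"
  proof -
    have "1 / \<epsilon> < real m"
      unfolding m_def by linarith
    moreover have "real m > 0"
      by (simp add: m_def)
    ultimately show "1 / real m < \<epsilon>"
      using \<epsilon> by (simp add: field_simps)
  qed (simp add: m_def)
  have \<alpha>: "\<alpha> > 0"
    by (simp add: \<alpha>_def)
  \<comment> \<open>For \<open>t = \<alpha> * n\<close> and \<open>p = c / n\<close> this is
    \<open>(t / (2 * k)) ^ k * p ^ k\<close>, in which n cancels.\<close>
  define \<kappa> where "\<kappa> k = (\<alpha> * c / (2 * real k)) ^ k" for k :: nat
  have \<kappa>: "\<kappa> k > 0" if "k \<ge> 1" for k
    using that \<alpha> assms(1) by (simp add: \<kappa>_def)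
  define few where "few n = {G. real (card (isolated_vertices G)) < \<alpha> * real n}" for n
  have lower: "\<forall>\<^sub>F n in sequentially.
      P n {G. lambda1 (H n G) < \<epsilon>} > 1 - \<delta>" if \<delta>: "\<delta> > 0" for \<delta>
  proof -
    \<comment> \<open>The first summands meet the size required for a broom cut; the last one pushes
      the probability of having no broom below \<open>\<delta> / 3\<close>. \<open>K\<close> depends
      on \<open>\<delta>\<close> but not on n.\<close>
    define K where "K = 3 * m + 2 + nat \<lceil>3 / (\<delta> * (\<alpha> * c * \<kappa> m))\<rceil>"
    have K: "K \<ge> 3 * m + 2" "K \<ge> 2"
      by (auto simp: K_def)
    have K\<delta>: "1 / (real K * (\<alpha> * c * \<kappa> m)) < \<delta> / 3"
    proof -
      have "3 / (\<delta> * (\<alpha> * c * \<kappa> m)) < real K"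
        unfolding K_def by linarith
      then show ?thesis
        using \<delta> \<alpha> \<kappa>[OF m(1)] assms(1) K by (simp add: field_simps)
    qed
    have "(\<lambda>n. P n (few n)) \<longlonglongrightarrow> 0"
      using prob_few_isolated_vertices_tendsto_0[of c] assms(1) by (simp add: P_def few_def \<alpha>_def)
    then have "\<forall>\<^sub>F n in sequentially. P n (few n) < \<delta> / 3"
      using \<delta> by (intro order_tendstoD) auto
    moreover have "(\<lambda>n. 1 / (\<alpha> * \<kappa> K) / real n) \<longlonglongrightarrow> 0"
      by (rule lim_const_over_n)
    then have "\<forall>\<^sub>F n in sequentially. 1 / (\<alpha> * \<kappa> K) / real n < \<delta> / 3"
      using \<delta> by (intro order_tendstoD) auto
    \<comment> \<open>This gives both \<open>p < 1\<close> and enough isolated vertices for stars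
      with \<open>K\<close> leaves.\<close>
    moreover have "\<forall>\<^sub>F n in sequentially. real n > c + (2 * real K + 2) / \<alpha>"
      using filterlim_real_sequentially by (simp add: filterlim_at_top_dense)
    ultimately show ?thesis
    proof eventually_elim
      case (elim n)
      define p where "p = c / real n"
      define t where "t = \<alpha> * real n"
      have n: "real n > c" "n > 0"
        using elim(3) \<alpha> assms(1) by (smt (verit) divide_nonneg_pos of_nat_0_le_iff of_nat_0_less_iff)+
      have p: "0 < p" "p < 1"
        using n assms(1) by (auto simp: p_def)
      have tK: "t \<ge> 2 * real K + 2"
      proof -
        have "(2 * real K + 2) / \<alpha> \<le> real n"
          using elim(3) assms(1) by simp
        then show ?thesis
          using \<alpha> by (simp add: t_def field_simps)
      qed
      then have tm: "t \<ge> 2 * real m + 2"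
        using K by linarith
      have giant: "is_giant_component G (H n G)" if "graph_on n G" for G
        using assms(2)[of n G] that n mem_set_pmf_gnp_iff[OF p] by (simp add: p_def)
      let ?A = "{G. graph_on n G \<and> t \<le> real (card (isolated_vertices G)) \<and>
        (\<forall>v\<in>verts G. card (neighbours G v) < K)}"
      let ?B = "{G. graph_on n G \<and> t \<le> real (card (isolated_vertices G)) \<and>
        K \<le> card (verts (H n G)) \<and> (\<forall>x\<in>verts (H n G). \<not> broom_centre m G x)}"
      have tp: "t * p = \<alpha> * c"
        using n by (simp add: t_def p_def)
      have \<kappa>tp: "\<kappa> k = (t / (2 * real k)) ^ k * p ^ k" for k
        by (simp add: \<kappa>_def tp[symmetric] power_mult_distrib[symmetric])
      have "P n ?A * (t * \<kappa> K) \<le> 1"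
        using prob_small_degrees_le[OF p K(2) tK] by (simp add: P_def p_def[symmetric] \<kappa>tp mult_ac)
      then have A: "P n ?A \<le> 1 / (\<alpha> * \<kappa> K) / real n"
        using \<alpha> \<kappa>[of K] K n by (simp add: t_def field_simps)
      have "P n ?B * (real K * (t * p * \<kappa> m)) \<le> 1"
        using prob_no_broom_le[OF p m(1) K(2) tm giant] by (simp add: P_def p_def[symmetric] \<kappa>tp mult_ac)
      then have "P n ?B * (real K * (\<alpha> * c * \<kappa> m)) \<le> 1"
        by (simp only: tp)
      then have B: "P n ?B \<le> 1 / (real K * (\<alpha> * c * \<kappa> m))"
        using \<alpha> \<kappa>[OF m(1)] K assms(1) by (simp add: field_simps)
      \<comment> \<open>Outside \<open>few n\<close>, failing \<open>?A\<close> yields a vertex of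
        degree at least \<open>K\<close>, so by maximality the giant component has at least
        \<open>K\<close> vertices; failing \<open>?B\<close> then yields a broom in it.\<close>
      have good: "lambda1 (H n G) < \<epsilon>"
        if G: "graph_on n G" and not: "G \<notin> few n" "G \<notin> ?A" "G \<notin> ?B" for G
      proof -
        obtain u where u: "u \<in> verts G" "H n G = induced_subgraph G (component_verts G u)"
          "\<And>w. w \<in> verts G \<Longrightarrow> card (component_verts G w) \<le> card (component_verts G u)"
          using is_giant_component_cases[OF giant[OF G]] by metis
        obtain v where v: "v \<in> verts G" "K \<le> card (neighbours G v)"
          using G not(1,2) by (auto simp: few_def t_def not_less)
        then have big: "K \<le> card (component_verts G u)"
          using card_neighbours_less_component[OF G v(1)] u(3)[OF v(1)] by linarith
        then obtain x where "x \<in> component_verts G u" "broom_centre m G x"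
          using G not(1,3) by (auto simp: few_def t_def not_less u(2))
        then have "lambda1 (H n G) \<le> 1 / real m"
          unfolding u(2) using big K by (intro lambda1_le_broom[OF G u(1) _ _ m(1)]) auto
        then show ?thesis
          using m(2) by linarith
      qed
      let ?S = "{G. lambda1 (H n G) < \<epsilon>}"
      \<comment> \<open>The complement is cut down to the support, since only there is
        \<open>H n G\<close> known to be a giant component.\<close>
      have "1 - P n ?S = P n (- ?S \<inter> set_pmf (gnp n p))"
        using measure_pmf.prob_compl[of ?S "gnp n p"]
        by (simp add: P_def p_def measure_Int_set_pmf Compl_eq_Diff_UNIV)
      also have "\<dots> \<le> P n (few n \<union> ?A \<union> ?B)"
        unfolding P_def
      proof (intro measure_pmf.finite_measure_mono subsetI)
        fix G assume "G \<in> - ?S \<inter> set_pmf (gnp n p)"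
        then have "graph_on n G" "\<not> lambda1 (H n G) < \<epsilon>"
          using mem_set_pmf_gnp_iff[OF p] by auto
        then show "G \<in> few n \<union> ?A \<union> ?B"
          using good[of G] by blast
      qed simp
      also have "\<dots> \<le> P n (few n \<union> ?A) + P n ?B"
        unfolding P_def by (rule measure_Un_le) auto
      also have "P n (few n \<union> ?A) \<le> P n (few n) + P n ?A"
        unfolding P_def by (rule measure_Un_le) auto
      finally show ?case
        using A B K\<delta> elim(1,2) by linarith
    qed
  qed
  have "(\<lambda>n. P n {G. lambda1 (H n G) < \<epsilon>}) \<longlonglongrightarrow> 1"
  proof (rule order_tendstoI)
    fix a :: real assume "a < 1"
    then show "\<forall>\<^sub>F n in sequentially. a < P n {G. lambda1 (H n G) < \<epsilon>}"
      using lower[of "1 - a"] by simp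
  next
    fix a :: real assume "1 < a"
    then show "\<forall>\<^sub>F n in sequentially. P n {G. lambda1 (H n G) < \<epsilon>} < a"
      by (auto simp: P_def intro!: always_eventually le_less_trans[OF measure_pmf.prob_le_1])
  qed
  then show "(\<lambda>n. measure_pmf.prob (gnp n (c / real n)) {G. lambda1 (H n G) < \<epsilon>}) \<longlonglongrightarrow> 1"
    by (simp add: P_def)
qed

end
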